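(* If $F$ is a random continuous function, then the measure $\lambda\circ F^{-1}$ induced by $F$ is not a random measure.
   Context: $\lambda$ is the uniform (Lebesgue) measure on $2^\omega$; random continuous functions are total, so $\lambda\circ F^{-1}$ is a Borel probability measure on $2^\omega$. Martin-Löf randomness of $x\in n^\omega$ is with respect to the uniform measure $\lambda_n$: $x$ is Martin-Löf random if $x\notin\bigcap_iU_i$ for every uniformly $\Sigma^0_1$ sequence $(U_i)$ of open subsets of $n^\omega$ with $\lambda_n(U_i)\le2^{-i}$. Random continuous functions: let $\sigma_0=\epsilon,\sigma_1=0,\sigma_2=1,\dots$ be the length-lexicographic enumeration of $2^{<\omega}$. For $x\in3^\omega$ label node $\sigma_i$ ($i\ge1$) by $\ell_x(\sigma_i)=x(i-1)$, and let $F_x(y)$ be the sequence obtained from $\ell_x(y\restriction1),\ell_x(y\restriction2),\dots$ by deleting all $2$'s (undefined if only finitely many entries remain). $F$ is a random continuous function if $F=F_x$ for some Martin-Löf random $x\in3^\omega$. Random measures: fix a computable bijection $\langle\cdot,\cdot\rangle:\omega^2\to\omega$. For $x\in2^\omega$ let its $n$-th column $x_n\in2^\omega$ be $x_n(k)=x(\langle n,k\rangle)$, identified with the real $\sum_kx_n(k)2^{-(k+1)}\in[0,1]$. Then $\mu_x$ is the unique Borel probability measure on $2^\omega$ with $\mu_x(\llbracket\sigma_n0\rrbracket)=x_n\cdot\mu_x(\llbracket\sigma_n\rrbracket)$ for all $n$. A measure $\mu$ is a random measure if $\mu=\mu_x$ for some Martin-Löf random $x\in2^\omega$. *)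

theory Defs
  imports "HOL-Probability.Probability" "HOL-Library.Nat_Bijection" "HOL-Library.Infinite_Set"
begin

datatype recf = Zf | Sf | Proj nat | Comp recf "recf list" | Prim recf recf | Mn recf

inductive eval_recf :: "recf \<Rightarrow> nat list \<Rightarrow> nat \<Rightarrow> bool" where
  ev_Z: "eval_recf Zf xs 0"
| ev_S: "eval_recf Sf (x # xs) (Suc x)"
| ev_Proj: "i < length xs \<Longrightarrow> eval_recf (Proj i) xs (xs ! i)"
| ev_Comp: "list_all2 (\<lambda>f y. eval_recf f xs y) fs ys \<Longrightarrow> eval_recf g ys r
             \<Longrightarrow> eval_recf (Comp g fs) xs r"
| ev_Prim0: "eval_recf f xs r \<Longrightarrow> eval_recf (Prim f g) (0 # xs) r"
| ev_PrimS: "eval_recf (Prim f g) (n # xs) r \<Longrightarrow> eval_recf g (r # n # xs) r'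
             \<Longrightarrow> eval_recf (Prim f g) (Suc n # xs) r'"
| ev_Mn: "eval_recf f (n # xs) 0 \<Longrightarrow> (\<forall>m<n. \<exists>r. r > 0 \<and> eval_recf f (m # xs) r)
             \<Longrightarrow> eval_recf (Mn f) xs n"

definition ce_set :: "nat set \<Rightarrow> bool" where
  "ce_set W \<longleftrightarrow> (\<exists>f. W = {k. \<exists>r. eval_recf f [k] r})"

definition seq_space :: "nat \<Rightarrow> (nat \<Rightarrow> nat) set" where
  "seq_space n = {x. \<forall>k. x k < n}"

definition unif_seq :: "nat \<Rightarrow> (nat \<Rightarrow> nat) measure" where
  "unif_seq n = Pi\<^sub>M UNIV (\<lambda>_. measure_pmf (pmf_of_set {..<n}))"

definition cyl :: "nat list \<Rightarrow> (nat \<Rightarrow> nat) set" where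
  "cyl s = {z. \<forall>i<length s. z i = s ! i}"

text \<open>The i-th open set of the uniformly Sigma^0_1 sequence coded by the c.e. set W,
  relative to the space n^omega.\<close>
definition open_of :: "nat \<Rightarrow> nat set \<Rightarrow> nat \<Rightarrow> (nat \<Rightarrow> nat) set" where
  "open_of n W i = seq_space n \<inter>
     (\<Union>{cyl s | s. set s \<subseteq> {..<n} \<and> prod_encode (i, list_encode s) \<in> W})"

definition mlrandom :: "nat \<Rightarrow> (nat \<Rightarrow> nat) \<Rightarrow> bool" where
  "mlrandom n x \<longleftrightarrow> x \<in> seq_space n \<and>
     (\<forall>W. ce_set W \<and> (\<forall>i. measure (unif_seq n) (open_of n W i) \<le> (1/2) ^ i)
          \<longrightarrow> x \<notin> (\<Inter>i. open_of n W i))"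

definition cantor :: "(nat \<Rightarrow> bool) measure" where
  "cantor = Pi\<^sub>M UNIV (\<lambda>_. measure_pmf (pmf_of_set (UNIV :: bool set)))"

definition cylB :: "bool list \<Rightarrow> (nat \<Rightarrow> bool) set" where
  "cylB s = {y. \<forall>i<length s. y i = s ! i}"

text \<open>Length-lexicographic enumeration of binary strings (False = 0, True = 1):
  sigma n is the binary expansion of n+1 with its leading 1 removed.\<close>
function tail_bits :: "nat \<Rightarrow> bool list" where
  "tail_bits k = (if k \<le> 1 then [] else tail_bits (k div 2) @ [odd k])"
  by auto
termination by (relation "Wellfounded.measure id") auto

definition sigma :: "nat \<Rightarrow> bool list" where
  "sigma n = tail_bits (Suc n)"

text \<open>Index of a string in the enumeration (inverse of sigma).\<close>
definition str_index :: "bool list \<Rightarrow> nat" where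
  "str_index s = foldl (\<lambda>a b. 2 * a + (if b then 1 else 0)) 1 s - 1"

text \<open>Label of the node y|(k+1): x(i-1) where sigma i = y|(k+1).\<close>
definition lab :: "(nat \<Rightarrow> nat) \<Rightarrow> (nat \<Rightarrow> bool) \<Rightarrow> nat \<Rightarrow> nat" where
  "lab x y k = x (str_index (map y [0..<Suc k]) - 1)"

text \<open>F_x(y): delete all 2's from the label sequence; totalised arbitrarily when only
  finitely many entries remain (this never happens for random x).\<close>
definition Fx :: "(nat \<Rightarrow> nat) \<Rightarrow> (nat \<Rightarrow> bool) \<Rightarrow> (nat \<Rightarrow> bool)" where
  "Fx x y = (if infinite {k. lab x y k \<noteq> 2}
             then (\<lambda>j. lab x y (enumerate {k. lab x y k \<noteq> 2} j) = 1)
             else (\<lambda>_. False))"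

definition random_continuous_function :: "((nat \<Rightarrow> bool) \<Rightarrow> (nat \<Rightarrow> bool)) \<Rightarrow> bool" where
  "random_continuous_function F \<longleftrightarrow> (\<exists>x. mlrandom 3 x \<and> F = Fx x)"

definition column :: "(nat \<Rightarrow> nat) \<Rightarrow> nat \<Rightarrow> real" where
  "column x n = (\<Sum>k. real (x (prod_encode (n, k))) * (1/2) ^ (Suc k))"

definition mu_of :: "(nat \<Rightarrow> nat) \<Rightarrow> (nat \<Rightarrow> bool) measure" where
  "mu_of x = (THE \<mu>. prob_space \<mu> \<and> sets \<mu> = sets cantor \<and>
      (\<forall>n. measure \<mu> (cylB (sigma n @ [False])) = column x n * measure \<mu> (cylB (sigma n))))"

definition random_measure :: "(nat \<Rightarrow> bool) measure \<Rightarrow> bool" where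
  "random_measure \<mu> \<longleftrightarrow> (\<exists>x. mlrandom 2 x \<and> \<mu> = mu_of x)"

end

theory Submission
  imports Defs
begin

text \<open>Both measures are compared through the largest mass of a cylinder of length about \<open>n\<close>.

  Let \<open>F = F\<^sub>x\<close>. The mass of \<open>F\<^sup>-\<^sup>1\<close> of a fixed cylinder of length \<open>n\<close> obeys a recursion over the two
  subtrees of the label tree, which are independent; it bounds the third moment by \<open>15 / 8 ^ n\<close>. As there
  are only \<open>2 ^ n\<close> cylinders, and \<open>2 / 8 < (16/25) ^ 3\<close>, Markov's inequality yields a Martin-Loef test showing
  that eventually all of them have mass at most \<open>(16/25) ^ n\<close>.

  In a random measure, descend from the node \<open>1\<close>, always to the child that the first three bits of the
  column declare the heavier one. Its share is at least \<open>4/8\<close>, \<open>5/8\<close>, \<open>6/8\<close> or \<open>7/8\<close>, with probability \<open>1/4\<close>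
  each, so the inverse of the product of these bounds has expectation \<open>(319/210) ^ n\<close>. Since
  \<open>319/210 < 20/13\<close>, Markov's inequality yields a test showing that eventually the path has mass above a
  constant times \<open>(13/20) ^ n\<close>, and \<open>16/25 < 13/20\<close>. Taking \<open>n = 60 i\<close> makes the measures of the \<open>i\<close>-th sets
  at most \<open>2 ^ -i\<close>. Starting at the node \<open>1\<close> keeps clear of the points where \<open>F\<close> is undefined, which the
  totalisation sends to \<open>000\<dots>\<close>.\<close>

section \<open>Computable functions\<close>

text \<open>The order of the moment and the number of bits depend on each other. A bound of order
  \<open>2 ^ -(p n)\<close> on the p-th moment, summed over \<open>2 ^ n\<close> cylinders, controls
  masses only at rates above \<open>2 ^ (1/p - 1)\<close>: about 0.707 for p = 2, about 0.630 for p
  = 3. Reading b bits of each column controls the path only at rates below 1/2, 3/5, 210/319 (about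
  0.658) for b = 1, 2, 3. So three bits are too few for second moments and two are too few for third
  moments, while third moments with three bits leave room for 0.64 and 0.65.

  Randomness is accessible only through effective tests, so every bad event has to be a search for a
  decidable property of finitely many entries; this is why masses reappear as products and counts of
  natural numbers. In a random measure the columns visited depend on earlier bits, and independence
  has to be recovered by fixing the node reached. For \<open>F\<close> only upper bounds are wanted,
  so preimages are enlarged to unions of clopen sets.\<close>

inductive_cases ev_ZE: "eval_recf Zf xs r"
inductive_cases ev_SE: "eval_recf Sf xs r"
inductive_cases ev_ProjE: "eval_recf (Proj i) xs r"
inductive_cases ev_CompE: "eval_recf (Comp g fs) xs r"
inductive_cases ev_Prim0E: "eval_recf (Prim f g) (0 # xs) r"
inductive_cases ev_PrimSE: "eval_recf (Prim f g) (Suc n # xs) r"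
inductive_cases ev_MnE: "eval_recf (Mn f) xs r"

text \<open>Programs are given by a relation, so a value found by unbounded search can be compared
  with the intended one only through determinism.\<close>

lemma eval_recf_det: "eval_recf f xs r \<Longrightarrow> eval_recf f xs r' \<Longrightarrow> r = r'"
proof (induction f xs r arbitrary: r' rule: eval_recf.induct)
  case (ev_Comp xs fs ys g r)
  from ev_Comp.prems obtain ys' where ys': "list_all2 (\<lambda>f. eval_recf f xs) fs ys'" "eval_recf g ys' r'"
    by (auto elim: ev_CompE)
  have "ys = ys'"
    using ev_Comp.IH(1) ys'(1) by (auto simp: list_all2_conv_all_nth intro!: nth_equalityI)
  then show ?case using ev_Comp.IH(2) ys'(2) by simp
next
  case (ev_PrimS f g n xs r s)
  from ev_PrimS.prems obtain t where "eval_recf (Prim f g) (n # xs) t" "eval_recf g (t # n # xs) r'"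
    by (auto elim: ev_PrimSE)
  then show ?case using ev_PrimS.IH by metis
next
  case (ev_Mn f n xs)
  from ev_Mn.prems have r': "eval_recf f (r' # xs) 0" "\<forall>m<r'. \<exists>r>0. eval_recf f (m # xs) r"
    by (auto elim: ev_MnE)
  show ?case
  proof (rule linorder_cases[of n r'])
    assume "n < r'" then show ?thesis using r'(2) ev_Mn.IH by (metis less_irrefl)
  next
    assume "r' < n" then show ?thesis using r'(1) ev_Mn.IH by (metis less_irrefl)
  qed
next
  case (ev_Prim0 f xs r g)
  then show ?case by (blast elim: ev_Prim0E)
qed (blast elim: ev_ZE, (erule ev_SE, simp), (erule ev_ProjE, simp))

text \<open>All functions take a single argument list, so closure rules speak about terms in
  \<open>xs\<close> and, collected in \<open>rec_intros\<close>, reduce computability of an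
  expression to its syntax. Lists of other lengths are left unconstrained.\<close>

definition total_rec :: "nat \<Rightarrow> (nat list \<Rightarrow> nat) \<Rightarrow> bool" where
  "total_rec k f \<longleftrightarrow> (\<exists>r. \<forall>xs. length xs = k \<longrightarrow> eval_recf r xs (f xs))"

definition decidable :: "nat \<Rightarrow> (nat list \<Rightarrow> bool) \<Rightarrow> bool" where
  "decidable k P \<longleftrightarrow> total_rec k (\<lambda>xs. if P xs then 1 else 0)"

named_theorems rec_intros

lemma total_rec_cong:
  assumes "total_rec k f" "\<And>xs. length xs = k \<Longrightarrow> f xs = g xs"
  shows "total_rec k g"
  using assms unfolding total_rec_def by metis

lemma total_rec_nth [rec_intros]: "i < k \<Longrightarrow> total_rec k (\<lambda>xs. xs ! i)"
  unfolding total_rec_def using ev_Proj by blast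

lemma total_rec_compose:
  assumes "total_rec (length gs) f" "\<And>g. g \<in> set gs \<Longrightarrow> total_rec k g"
  shows "total_rec k (\<lambda>xs. f (map (\<lambda>g. g xs) gs))"
proof -
  obtain r where r: "\<And>xs. length xs = length gs \<Longrightarrow> eval_recf r xs (f xs)"
    using assms(1) by (auto simp: total_rec_def)
  have "\<forall>g\<in>set gs. \<exists>r. \<forall>xs. length xs = k \<longrightarrow> eval_recf r xs (g xs)"
    using assms(2) by (auto simp: total_rec_def)
  then obtain R where R: "\<And>g xs. g \<in> set gs \<Longrightarrow> length xs = k \<Longrightarrow> eval_recf (R g) xs (g xs)"
    by metis
  have "eval_recf (Comp r (map R gs)) xs (f (map (\<lambda>g. g xs) gs))" if "length xs = k" for xs
    by (rule ev_Comp[where ys = "map (\<lambda>g. g xs) gs"])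
       (auto simp: list_all2_conv_all_nth R that r)
  then show ?thesis unfolding total_rec_def by blast
qed

lemma total_rec_compose1:
  assumes "total_rec 1 (\<lambda>xs. f (xs ! 0))" "total_rec k a"
  shows "total_rec k (\<lambda>xs. f (a xs))"
  using total_rec_compose[of "[a]" "\<lambda>xs. f (xs ! 0)" k] assms by auto

lemma total_rec_compose2:
  assumes "total_rec 2 (\<lambda>xs. f (xs ! 0) (xs ! 1))" "total_rec k a" "total_rec k b"
  shows "total_rec k (\<lambda>xs. f (a xs) (b xs))"
proof -
  have "total_rec k (\<lambda>xs. (\<lambda>xs. f (xs ! 0) (xs ! 1)) (map (\<lambda>g. g xs) [a, b]))"
    by (rule total_rec_compose) (use assms in \<open>auto simp: numeral_2_eq_2\<close>)
  then show ?thesis by simp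
qed

lemma decidable_compose3:
  assumes "decidable 3 (\<lambda>xs. P (xs ! 0) (xs ! 1) (xs ! 2))"
    "total_rec k a" "total_rec k b" "total_rec k c"
  shows "decidable k (\<lambda>xs. P (a xs) (b xs) (c xs))"
proof -
  have "total_rec k (\<lambda>xs. (\<lambda>ys. if P (ys ! 0) (ys ! 1) (ys ! 2) then 1 else 0) (map (\<lambda>g. g xs) [a, b, c]))"
    by (rule total_rec_compose) (use assms in \<open>auto simp: decidable_def numeral_3_eq_3\<close>)
  then show ?thesis by (simp add: decidable_def)
qed

lemma total_rec_Suc [rec_intros]:
  assumes "total_rec k f" shows "total_rec k (\<lambda>xs. Suc (f xs))"
proof (rule total_rec_compose1[OF _ assms])
  have "eval_recf Sf xs (Suc (xs ! 0))" if "length xs = 1" for xs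
    using that by (cases xs) (auto intro: ev_S)
  then show "total_rec 1 (\<lambda>xs. Suc (xs ! 0))" unfolding total_rec_def by blast
qed

lemma total_rec_const [rec_intros]: "total_rec k (\<lambda>_. c)"
proof (induction c)
  case 0 show ?case unfolding total_rec_def using ev_Z by blast
next
  case (Suc c) then show ?case by (rule total_rec_Suc)
qed

text \<open>\<open>Prim\<close> passes the recursive value before the counter, hence
  \<open>hd xs\<close> is the value and \<open>hd (tl xs)\<close> the counter. Composing with
  \<open>t\<close> and all projections then replaces the counter by \<open>t xs\<close>.\<close>

lemma total_rec_recursion:
  assumes g: "total_rec k g" and h: "total_rec (Suc (Suc k)) (\<lambda>xs. h (hd (tl xs)) (hd xs) (tl (tl xs)))"
    and t: "total_rec k t"
  shows "total_rec k (\<lambda>xs. rec_nat (g xs) (\<lambda>n r. h n r xs) (t xs))"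
proof -
  obtain rg where rg: "\<And>xs. length xs = k \<Longrightarrow> eval_recf rg xs (g xs)"
    using g by (auto simp: total_rec_def)
  obtain rh where rh: "\<And>xs. length xs = Suc (Suc k) \<Longrightarrow> eval_recf rh xs (h (hd (tl xs)) (hd xs) (tl (tl xs)))"
    using h by (auto simp: total_rec_def)
  have "eval_recf (Prim rg rh) (n # xs) (rec_nat (g xs) (\<lambda>n r. h n r xs) n)" if "length xs = k" for n xs
  proof (induction n)
    case 0 show ?case using ev_Prim0[OF rg[OF that]] by simp
  next
    case (Suc n)
    have "eval_recf rh (rec_nat (g xs) (\<lambda>n r. h n r xs) n # n # xs) (h n (rec_nat (g xs) (\<lambda>n r. h n r xs) n) xs)"
      using rh[of "rec_nat (g xs) (\<lambda>n r. h n r xs) n # n # xs"] that by simp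
    from ev_PrimS[OF Suc this] show ?case by simp
  qed
  then have "total_rec (Suc k) (\<lambda>xs. rec_nat (g (tl xs)) (\<lambda>n r. h n r (tl xs)) (hd xs))"
    unfolding total_rec_def
    by (intro exI[of _ "Prim rg rh"]) (metis length_Suc_conv list.sel(1) list.sel(3))
  then have "total_rec k (\<lambda>xs. (\<lambda>xs. rec_nat (g (tl xs)) (\<lambda>n r. h n r (tl xs)) (hd xs))
      (map (\<lambda>g. g xs) (t # map (\<lambda>i xs. xs ! i) [0..<k])))"
    by (intro total_rec_compose) (auto simp: t intro: rec_intros)
  then show ?thesis
  proof (rule total_rec_cong, goal_cases)
    case (1 xs)
    then have "map (\<lambda>i. xs ! i) [0..<k] = xs" by (metis map_nth)
    then show ?case by (simp add: comp_def)
  qed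
qed

text \<open>Bounded sums, bounded quantifiers and recursions put their variables in front of
  \<open>xs\<close>, so outer variables appear behind tails. Three tails are the depth of
  \<open>large_mass\<close>: a sum over nodes, a quantifier over labels, a sum counting
  outputs.\<close>

lemma total_rec_tl_nth [rec_intros]:
  "Suc i < k \<Longrightarrow> total_rec k (\<lambda>xs. tl xs ! i)"
  "Suc (Suc i) < k \<Longrightarrow> total_rec k (\<lambda>xs. tl (tl xs) ! i)"
  "Suc (Suc (Suc i)) < k \<Longrightarrow> total_rec k (\<lambda>xs. tl (tl (tl xs)) ! i)"
  by (rule total_rec_cong[OF total_rec_nth], assumption, simp add: nth_tl)+

lemma total_rec_hd [rec_intros]:
  "0 < k \<Longrightarrow> total_rec k (\<lambda>xs. hd xs)"
  "1 < k \<Longrightarrow> total_rec k (\<lambda>xs. hd (tl xs))"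
  "2 < k \<Longrightarrow> total_rec k (\<lambda>xs. hd (tl (tl xs)))"
  by (rule total_rec_cong[OF total_rec_nth], assumption,
      simp add: hd_conv_nth nth_tl numeral_2_eq_2 numeral_3_eq_3 flip: length_greater_0_conv)+

lemma total_rec_add [rec_intros]:
  assumes "total_rec k a" "total_rec k b" shows "total_rec k (\<lambda>xs. a xs + b xs)"
proof (rule total_rec_compose2[OF _ assms])
  have "total_rec 2 (\<lambda>xs. rec_nat (xs ! 0) (\<lambda>n r. Suc r) (xs ! 1))"
    by (intro total_rec_recursion rec_intros) simp_all
  moreover have "rec_nat x (\<lambda>n. Suc) y = x + y" for x y by (induction y) auto
  ultimately show "total_rec 2 (\<lambda>xs. xs ! 0 + xs ! 1)" by simp
qed

lemma total_rec_mult [rec_intros]: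
  assumes "total_rec k a" "total_rec k b" shows "total_rec k (\<lambda>xs. a xs * b xs)"
proof (rule total_rec_compose2[OF _ assms])
  have "total_rec 2 (\<lambda>xs. rec_nat 0 (\<lambda>n r. r + xs ! 0) (xs ! 1))"
    by (intro total_rec_recursion rec_intros) simp_all
  moreover have "rec_nat 0 (\<lambda>n r. r + x) y = x * y" for x y :: nat by (induction y) auto
  ultimately show "total_rec 2 (\<lambda>xs. xs ! 0 * xs ! 1)" by simp
qed

lemma total_rec_power [rec_intros]:
  assumes "total_rec k a" "total_rec k b" shows "total_rec k (\<lambda>xs. a xs ^ b xs)"
proof (rule total_rec_compose2[OF _ assms])
  have "total_rec 2 (\<lambda>xs. rec_nat 1 (\<lambda>n r. r * xs ! 0) (xs ! 1))"
    by (intro total_rec_recursion rec_intros) simp_all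
  moreover have "rec_nat (Suc 0) (\<lambda>n r. r * x) y = x ^ y" for x y :: nat by (induction y) auto
  ultimately show "total_rec 2 (\<lambda>xs. xs ! 0 ^ xs ! 1)" by simp
qed

lemma total_rec_diff [rec_intros]:
  assumes "total_rec k a" "total_rec k b" shows "total_rec k (\<lambda>xs. a xs - b xs)"
proof (rule total_rec_compose2[OF _ assms])
  have "total_rec 1 (\<lambda>xs. rec_nat 0 (\<lambda>n r. n) (xs ! 0))"
    by (intro total_rec_recursion rec_intros) simp_all
  moreover have "rec_nat 0 (\<lambda>n r. n) y = y - 1" for y by (induction y) auto
  ultimately have pred: "total_rec 1 (\<lambda>xs. xs ! 0 - 1)" by simp
  have "total_rec 2 (\<lambda>xs. rec_nat (xs ! 0) (\<lambda>n r. r - 1) (xs ! 1))"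
    by (rule total_rec_recursion) (auto intro!: rec_intros total_rec_compose1[OF pred, simplified])
  moreover have "rec_nat x (\<lambda>n r. r - 1) y = x - y" for x y :: nat by (induction y) auto
  ultimately show "total_rec 2 (\<lambda>xs. xs ! 0 - xs ! 1)" by simp
qed

lemma total_rec_sum [rec_intros]:
  assumes "total_rec (Suc k) (\<lambda>xs. f (hd xs) (tl xs))" "total_rec k t"
  shows "total_rec k (\<lambda>xs. \<Sum>i<t xs. f i xs)"
proof -
  obtain r where r: "\<And>xs. length xs = Suc k \<Longrightarrow> eval_recf r xs (f (hd xs) (tl xs))"
    using assms(1) by (auto simp: total_rec_def)
  \<comment> \<open>Projecting away the accumulator at the head leaves the summation index and the
    parameters.\<close>
  have "total_rec (Suc (Suc k)) (\<lambda>xs. (\<lambda>xs. f (hd xs) (tl xs)) (map (\<lambda>g. g xs) (map (\<lambda>i xs. xs ! Suc i) [0..<Suc k])))"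
    by (rule total_rec_compose) (auto simp del: upt_Suc intro!: rec_intros assms)
  then have f: "total_rec (Suc (Suc k)) (\<lambda>xs. f (hd (tl xs)) (tl (tl xs)))"
  proof (rule total_rec_cong, goal_cases)
    case (1 xs)
    have "map (\<lambda>i. xs ! Suc i) [0..<Suc k] = tl xs"
      using 1 by (intro nth_equalityI) (auto simp: nth_tl simp del: upt_Suc)
    then show ?case by (simp add: comp_def del: upt_Suc)
  qed
  have "total_rec k (\<lambda>xs. rec_nat 0 (\<lambda>n r. r + f n xs) (t xs))"
    by (intro total_rec_recursion rec_intros assms f) simp_all
  moreover have "rec_nat 0 (\<lambda>n r. r + f n xs) m = (\<Sum>i<m. f i xs)" for m xs
    by (induction m) auto
  ultimately show ?thesis by simp
qed

section \<open>Decidable predicates and functions defined from them\<close>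

lemma decidable_less [rec_intros]:
  assumes "total_rec k a" "total_rec k b" shows "decidable k (\<lambda>xs. a xs < b xs)"
proof -
  \<comment> \<open>Truncated subtraction makes this the indicator of
    \<open>a xs < b xs\<close>.\<close>
  have "total_rec k (\<lambda>xs. 1 - (1 - (b xs - a xs)))" by (intro rec_intros assms)
  then show ?thesis unfolding decidable_def by (rule total_rec_cong) auto
qed

lemma decidable_not [rec_intros]:
  assumes "decidable k P" shows "decidable k (\<lambda>xs. \<not> P xs)"
proof -
  have "total_rec k (\<lambda>xs. 1 - (if P xs then 1 else 0))"
    by (intro rec_intros assms[unfolded decidable_def])
  then show ?thesis unfolding decidable_def by (rule total_rec_cong) auto
qed

lemma decidable_conj [rec_intros]:
  assumes "decidable k P" "decidable k Q" shows "decidable k (\<lambda>xs. P xs \<and> Q xs)"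
proof -
  have "total_rec k (\<lambda>xs. (if P xs then 1 else 0) * (if Q xs then 1 else 0))"
    by (intro rec_intros assms[unfolded decidable_def])
  then show ?thesis unfolding decidable_def by (rule total_rec_cong) auto
qed

lemma decidable_cong:
  assumes "decidable k P" "\<And>xs. length xs = k \<Longrightarrow> P xs = Q xs"
  shows "decidable k Q"
  using assms(1) unfolding decidable_def by (rule total_rec_cong) (simp add: assms(2))

lemma decidable_le [rec_intros]:
  assumes "total_rec k a" "total_rec k b" shows "decidable k (\<lambda>xs. a xs \<le> b xs)"
proof -
  have "decidable k (\<lambda>xs. \<not> b xs < a xs)" by (intro rec_intros assms)
  then show ?thesis by (simp add: not_less)
qed

lemma decidable_eq [rec_intros]:
  assumes "total_rec k a" "total_rec k b" shows "decidable k (\<lambda>xs. a xs = b xs)"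
proof -
  have "decidable k (\<lambda>xs. a xs \<le> b xs \<and> b xs \<le> a xs)" by (intro rec_intros assms)
  then show ?thesis by (rule decidable_cong) auto
qed

lemma total_rec_if [rec_intros]:
  assumes "decidable k P" "total_rec k a" "total_rec k b"
  shows "total_rec k (\<lambda>xs. if P xs then a xs else b xs)"
proof -
  have "total_rec k (\<lambda>xs. (if P xs then 1 else 0) * a xs + (1 - (if P xs then 1 else 0)) * b xs)"
    by (intro rec_intros assms assms(1)[unfolded decidable_def])
  then show ?thesis by (rule total_rec_cong) auto
qed

lemma decidable_ball [rec_intros]:
  assumes "decidable (Suc k) (\<lambda>xs. P (hd xs) (tl xs))" "total_rec k t"
  shows "decidable k (\<lambda>xs. \<forall>i<t xs. P i xs)"
proof -
  have "decidable k (\<lambda>xs. (\<Sum>i<t xs. if P i xs then 0 else 1) = (0::nat))"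
    by (intro rec_intros assms)
  then show ?thesis by (rule decidable_cong) (auto split: if_splits)
qed

text \<open>The quotient of m by n > 0 is the number of q < m with (q + 1) n \<le> m; the guard
  makes division by 0 yield 0, as in HOL.\<close>

lemma total_rec_div [rec_intros]:
  assumes "total_rec k a" "total_rec k b" shows "total_rec k (\<lambda>xs. a xs div b xs)"
proof (rule total_rec_compose2[OF _ assms])
  have "total_rec 2 (\<lambda>xs. \<Sum>q<xs ! 0. if xs ! 1 \<noteq> 0 \<and> Suc q * xs ! 1 \<le> xs ! 0 then 1 else 0)"
    by (intro rec_intros) simp_all
  moreover have "(\<Sum>q<m. if n \<noteq> 0 \<and> Suc q * n \<le> m then 1 else 0) = m div n" for m n :: nat
  proof (cases "n = 0")
    case False
    then have "{q. q < m \<and> Suc q * n \<le> m} = {..<m div n}"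
      by (auto simp: less_eq_div_iff_mult_less_eq[symmetric] Suc_le_eq simp del: mult_Suc
               intro: less_le_trans[OF _ div_le_dividend])
    then show ?thesis using False
      by (simp add: sum.If_cases Int_def del: mult_Suc)
  qed simp
  ultimately show "total_rec 2 (\<lambda>xs. xs ! 0 div xs ! 1)" by simp
qed

lemma total_rec_mod [rec_intros]:
  assumes "total_rec k a" "total_rec k b" shows "total_rec k (\<lambda>xs. a xs mod b xs)"
  unfolding modulo_nat_def by (intro rec_intros assms)

lemma total_rec_prod_encode [rec_intros]:
  assumes "total_rec k a" "total_rec k b" shows "total_rec k (\<lambda>xs. prod_encode (a xs, b xs))"
  unfolding prod_encode_def triangle_def split_def fst_conv snd_conv by (intro rec_intros assms)

text \<open>Both components are bounded by the code, so decoding becomes a bounded double sum to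
  which a single pair of indices contributes.\<close>

lemma sum_prod_decode:
  "(\<Sum>a<Suc c. \<Sum>b<Suc c. if prod_encode (a, b) = c then f a b else 0)
     = f (fst (prod_decode c)) (snd (prod_decode c))" for f :: "nat \<Rightarrow> nat \<Rightarrow> nat"
proof -
  define m n where "m = fst (prod_decode c)" and "n = snd (prod_decode c)"
  have c: "prod_encode (m, n) = c" by (simp add: m_def n_def)
  have "m \<le> c" "n \<le> c" using le_prod_encode_1[of m n] le_prod_encode_2[of n m] c by auto
  have "prod_encode (a, b) = c \<longleftrightarrow> a = m \<and> b = n" for a b
    using c by (metis old.prod.inject prod_encode_inverse)
  then have "(\<Sum>a<Suc c. \<Sum>b<Suc c. if prod_encode (a, b) = c then f a b else 0)
     = (\<Sum>a<Suc c. if a = m then \<Sum>b<Suc c. if b = n then f a b else 0 else 0)"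
    by (intro sum.cong) auto
  then show ?thesis using \<open>m \<le> c\<close> \<open>n \<le> c\<close> by (simp add: m_def n_def del: sum.lessThan_Suc)
qed

lemma total_rec_prod_decode [rec_intros]:
  assumes "total_rec k a"
  shows "total_rec k (\<lambda>xs. fst (prod_decode (a xs)))" "total_rec k (\<lambda>xs. snd (prod_decode (a xs)))"
proof -
  have "total_rec 1 (\<lambda>xs. \<Sum>a<Suc (xs ! 0). \<Sum>b<Suc (xs ! 0). if prod_encode (a, b) = xs ! 0 then a else 0)"
    "total_rec 1 (\<lambda>xs. \<Sum>a<Suc (xs ! 0). \<Sum>b<Suc (xs ! 0). if prod_encode (a, b) = xs ! 0 then b else 0)"
    by (intro rec_intros; simp)+
  then have d: "total_rec 1 (\<lambda>xs. fst (prod_decode (xs ! 0)))" "total_rec 1 (\<lambda>xs. snd (prod_decode (xs ! 0)))"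
    unfolding sum_prod_decode by simp_all
  show "total_rec k (\<lambda>xs. fst (prod_decode (a xs)))"
    using d(1) assms by (rule total_rec_compose1)
  show "total_rec k (\<lambda>xs. snd (prod_decode (a xs)))"
    using d(2) assms by (rule total_rec_compose1)
qed

lemma decidable_imp [rec_intros]:
  assumes "decidable k P" "decidable k Q" shows "decidable k (\<lambda>xs. P xs \<longrightarrow> Q xs)"
proof -
  have "decidable k (\<lambda>xs. \<not> (P xs \<and> \<not> Q xs))" by (intro rec_intros assms)
  then show ?thesis by simp
qed

lemma decidable_iff [rec_intros]:
  assumes "decidable k P" "decidable k Q" shows "decidable k (\<lambda>xs. P xs \<longleftrightarrow> Q xs)"
proof -
  have "decidable k (\<lambda>xs. (P xs \<longrightarrow> Q xs) \<and> (Q xs \<longrightarrow> P xs))" by (intro rec_intros assms)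
  then show ?thesis by (rule decidable_cong) auto
qed

text \<open>The set is the domain of an unbounded search. \<open>Mn\<close> looks for the value 0,
  hence the program computes the indicator of the negation; its totality provides the positive
  values that \<open>Mn\<close> requires before the first witness.\<close>

lemma ce_set_exists:
  assumes "decidable 2 (\<lambda>xs. P (xs ! 0) (xs ! 1))"
  shows "ce_set {k. \<exists>m. P m k}"
proof -
  have "decidable 2 (\<lambda>xs. \<not> P (xs ! 0) (xs ! 1))" by (intro rec_intros assms)
  then obtain r where r: "\<And>xs. length xs = 2 \<Longrightarrow> eval_recf r xs (if P (xs ! 0) (xs ! 1) then 0 else 1)"
    unfolding decidable_def total_rec_def if_not_P if_cancel
    by (metis (full_types))
  have r': "eval_recf r [m, k] (if P m k then 0 else 1)" for m k using r[of "[m, k]"] by simp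
  have "(\<exists>m. P m k) \<longleftrightarrow> (\<exists>m. eval_recf (Mn r) [k] m)" for k
  proof
    assume ex: "\<exists>m. P m k"
    define m where "m = (LEAST m. P m k)"
    have "P m k" unfolding m_def using ex by (rule LeastI_ex)
    moreover have "\<not> P j k" if "j < m" for j using that not_less_Least unfolding m_def by blast
    ultimately have "eval_recf (Mn r) [k] m"
      by (intro ev_Mn) (metis r', metis r' zero_less_one)
    then show "\<exists>m. eval_recf (Mn r) [k] m" ..
  next
    assume "\<exists>m. eval_recf (Mn r) [k] m"
    then obtain m where "eval_recf r [m, k] 0" by (auto elim: ev_MnE)
    with r'[of m k] have "P m k" by (metis eval_recf_det zero_neq_one)
    then show "\<exists>m. P m k" ..
  qed
  then show ?thesis unfolding ce_set_def by auto
qed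

text \<open>Iterated tail on codes; the predecessor undoes the \<open>Suc\<close> in the code of a
  nonempty list. The code 0 of the empty list stays 0, as \<open>prod_decode 0 = (0, 0)\<close>, so
  on codes of lists a nonzero value says that the list is longer than \<open>j\<close>.\<close>

definition code_drop :: "nat \<Rightarrow> nat \<Rightarrow> nat" where
  "code_drop e j = rec_nat e (\<lambda>_ v. snd (prod_decode (v - 1))) j"

text \<open>\<open>code_nth e\<close> is itself an infinite sequence, so a predicate on sequences
  can be evaluated on a code; only entries below the length of the list are meaningful.\<close>

definition code_nth :: "nat \<Rightarrow> nat \<Rightarrow> nat" where
  "code_nth e j = fst (prod_decode (code_drop e j - 1))"

lemma code_drop_list_encode: "code_drop (list_encode s) j = list_encode (drop j s)"
proof (induction j)
  case (Suc j)
  have "snd (prod_decode (list_encode t - 1)) = list_encode (tl t)" for t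
  proof (cases t)
    case Nil
    have "prod_decode 0 = (0, 0)" by (simp add: prod_decode_def prod_decode_aux.simps)
    then show ?thesis using Nil by simp
  qed simp
  then show ?case using Suc by (simp add: code_drop_def drop_Suc tl_drop)
qed (simp add: code_drop_def)

lemma code_nth_list_encode: "j < length s \<Longrightarrow> code_nth (list_encode s) j = s ! j"
  by (simp add: code_nth_def code_drop_list_encode Cons_nth_drop_Suc[symmetric])

lemma list_encode_eq_0_iff: "list_encode s = 0 \<longleftrightarrow> s = []"
  by (cases s) auto

lemma total_rec_code_drop [rec_intros]:
  assumes "total_rec k a" "total_rec k b" shows "total_rec k (\<lambda>xs. code_drop (a xs) (b xs))"
  unfolding code_drop_def by (intro total_rec_recursion rec_intros assms) simp_all

lemma total_rec_code_nth [rec_intros]: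
  assumes "total_rec k a" "total_rec k b" shows "total_rec k (\<lambda>xs. code_nth (a xs) (b xs))"
  unfolding code_nth_def by (intro rec_intros assms)

section \<open>Product measures and tests\<close>

lemma integral_PiM_mult:
  fixes f g :: "('i \<Rightarrow> 'b) \<Rightarrow> real"
  assumes N: "prob_space N"
    and f: "f \<in> borel_measurable (PiM UNIV (\<lambda>_. N))" and g: "g \<in> borel_measurable (PiM UNIV (\<lambda>_. N))"
    and fB: "\<And>x. \<bar>f x\<bar> \<le> B" and gB: "\<And>x. \<bar>g x\<bar> \<le> C"
    and fJ: "\<And>x y. (\<And>j. j \<in> J \<Longrightarrow> x j = y j) \<Longrightarrow> f x = f y"
    and gK: "\<And>x y. (\<And>j. j \<in> K \<Longrightarrow> x j = y j) \<Longrightarrow> g x = g y"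
    and JK: "J \<inter> K = {}"
  shows "(\<integral>x. f x * g x \<partial>PiM UNIV (\<lambda>_. N)) = (\<integral>x. f x \<partial>PiM UNIV (\<lambda>_. N)) * (\<integral>x. g x \<partial>PiM UNIV (\<lambda>_. N))"
proof -
  let ?P = "PiM UNIV (\<lambda>_::'i. N)"
  interpret N: prob_space N by fact
  interpret P: prob_space ?P by (intro prob_space_PiM N)
  obtain d where d: "d \<in> space N" using N.not_empty by blast
  \<comment> \<open>The functions expect full families, so coordinates outside the block are filled
    with a fixed point of the space.\<close>
  define ext where "ext I w = (\<lambda>i. if i \<in> I then w i else d)" for I :: "'i set" and w :: "'i \<Rightarrow> 'b"
  have ext: "ext I \<in> PiM I (\<lambda>_. N) \<rightarrow>\<^sub>M ?P" for I
  proof (rule measurable_PiM_single')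
    show "(\<lambda>w. ext I w i) \<in> PiM I (\<lambda>_. N) \<rightarrow>\<^sub>M N" for i
      using d by (cases "i \<in> I") (auto simp: ext_def)
    show "ext I \<in> space (PiM I (\<lambda>_. N)) \<rightarrow> (\<Pi>\<^sub>E i\<in>UNIV. space N)"
      using d by (auto simp: ext_def space_PiM)
  qed
  have "distr ?P N (\<lambda>x. x i) = N" for i
    using distr_PiM_component[of UNIV "\<lambda>_. N" i] N by simp
  then have "P.indep_vars (\<lambda>_. N) (\<lambda>i x. x i) UNIV"
    by (subst P.indep_vars_iff_distr_eq_PiM') (auto simp: restrict_def distr_id)
  from P.indep_var_restrict[OF this JK]
  have "P.indep_var (PiM J (\<lambda>_. N)) (\<lambda>x. restrict x J) (PiM K (\<lambda>_. N)) (\<lambda>x. restrict x K)"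
    by simp
  from P.indep_var_compose[OF this measurable_compose[OF ext f] measurable_compose[OF ext g]]
  have "P.indep_var borel (\<lambda>x. f (ext J (restrict x J))) borel (\<lambda>x. g (ext K (restrict x K)))"
    by (simp add: comp_def)
  moreover have "f (ext J (restrict x J)) = f x" "g (ext K (restrict x K)) = g x" for x
    by (rule fJ, simp add: ext_def, rule gK, simp add: ext_def)
  ultimately have "P.indep_var borel f borel g" by simp
  moreover have "integrable ?P f" "integrable ?P g"
    using P.integrable_const_bound[OF _ f, of B] P.integrable_const_bound[OF _ g, of C] fB gB by auto
  ultimately show ?thesis by (rule P.indep_var_lebesgue_integral)
qed

lemma integral_PiM_reindex:
  fixes f :: "('i \<Rightarrow> 'b) \<Rightarrow> real" and h :: "'i \<Rightarrow> 'j"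
  assumes N: "prob_space N" and f: "f \<in> borel_measurable (PiM UNIV (\<lambda>_. N))" and h: "inj h"
  shows "(\<integral>x. f (\<lambda>i. x (h i)) \<partial>PiM UNIV (\<lambda>_. N)) = (\<integral>x. f x \<partial>PiM UNIV (\<lambda>_. N))"
proof -
  have "distr (PiM UNIV (\<lambda>_. N)) (PiM UNIV (\<lambda>_. N)) (\<lambda>x i. x (h i)) = PiM UNIV (\<lambda>_. N)"
    using distr_PiM_reindex[of UNIV "\<lambda>_. N" h UNIV] N h by (simp add: restrict_def)
  then have "(\<integral>x. f x \<partial>PiM UNIV (\<lambda>_. N)) = (\<integral>x. f x \<partial>distr (PiM UNIV (\<lambda>_. N)) (PiM UNIV (\<lambda>_. N)) (\<lambda>x i. x (h i)))"
    by simp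
  also have "\<dots> = (\<integral>x. f (\<lambda>i. x (h i)) \<partial>PiM UNIV (\<lambda>_. N))"
    by (rule integral_distr[OF _ f]) (rule measurable_PiM_single', auto simp: space_PiM)
  finally show ?thesis ..
qed

lemma space_unif_seq: "space (unif_seq n) = UNIV"
  by (simp add: unif_seq_def space_PiM)

lemma prob_space_unif_seq: "prob_space (unif_seq n)"
  unfolding unif_seq_def by (intro prob_space_PiM measure_pmf.prob_space_axioms)

lemma measurable_unif_seq_coord: "(\<lambda>x. x i) \<in> unif_seq n \<rightarrow>\<^sub>M count_space UNIV"
proof -
  have "(\<lambda>x. x i) \<in> unif_seq n \<rightarrow>\<^sub>M measure_pmf (pmf_of_set {..<n})"
    unfolding unif_seq_def by (rule measurable_component_singleton) simp
  then show ?thesis by simp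
qed

lemma cyl_sets: "cyl s \<in> sets (unif_seq n)"
proof -
  have [measurable]: "(\<lambda>x. x i) \<in> unif_seq n \<rightarrow>\<^sub>M count_space UNIV" for i
    by (rule measurable_unif_seq_coord)
  have "{x \<in> space (unif_seq n). \<forall>i\<in>{..<length s}. x i = s ! i} \<in> sets (unif_seq n)" by measurable
  then show ?thesis by (simp add: cyl_def space_unif_seq Ball_def)
qed

text \<open>The set is a union of cylinders, of which there are only countably many. Measurability
  of a predicate thus reduces to which coordinates it reads.\<close>

lemma finite_dependence_sets:
  assumes "\<And>x y. (\<And>j. j < N \<Longrightarrow> x j = y j) \<Longrightarrow> P x \<Longrightarrow> P y"
  shows "{x. P x} \<in> sets (unif_seq n)"
proof -
  have "{x. P x} = \<Union> (cyl ` {s. length s = N \<and> (\<forall>x\<in>cyl s. P x)})"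
  proof (intro equalityI subsetI; clarsimp)
    fix x assume "P x"
    then have "\<forall>y\<in>cyl (map x [0..<N]). P y"
      by (auto simp: cyl_def intro: assms[of x])
    then show "\<exists>s. length s = N \<and> (\<forall>x\<in>cyl s. P x) \<and> x \<in> cyl s"
      by (intro exI[of _ "map x [0..<N]"]) (auto simp: cyl_def)
  qed
  also have "\<dots> \<in> sets (unif_seq n)"
    by (intro sets.countable_UN' countableI_type) (auto intro: cyl_sets)
  finally show ?thesis .
qed

lemma seq_space_sets: "seq_space n \<in> sets (unif_seq m)"
proof -
  have [measurable]: "(\<lambda>x. x i) \<in> unif_seq m \<rightarrow>\<^sub>M count_space UNIV" for i
    by (rule measurable_unif_seq_coord)
  have "{x \<in> space (unif_seq m). \<forall>i. x i < n} \<in> sets (unif_seq m)" by measurable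
  then show ?thesis by (simp add: seq_space_def space_unif_seq)
qed

text \<open>The union of the tails of the given sequence is again a test (Solovay), so \<open>Q i\<close> fails
  for all but finitely many \<open>i\<close> and not merely for one.\<close>
lemma mlrandom_eventually_avoids:
  fixes Q :: "nat \<Rightarrow> nat \<Rightarrow> (nat \<Rightarrow> nat) \<Rightarrow> bool" and N :: "nat \<Rightarrow> nat \<Rightarrow> nat"
  assumes x: "mlrandom n x"
    and dec: "decidable 3 (\<lambda>xs. Q (xs ! 0) (xs ! 1) (code_nth (xs ! 2)))"
    and rec: "total_rec 2 (\<lambda>xs. N (xs ! 0) (xs ! 1))"
    and dep: "\<And>i m x y. (\<And>j. j < N i m \<Longrightarrow> x j = y j) \<Longrightarrow> Q i m x \<Longrightarrow> Q i m y"
    and meas: "\<And>i. measure (unif_seq n) {x \<in> seq_space n. \<exists>m. Q i m x} \<le> (1/2) ^ i"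
  shows "\<exists>i0. \<forall>i\<ge>i0. \<forall>m. \<not> Q i m x"
proof -
  interpret prob_space "unif_seq n" by (rule prob_space_unif_seq)
  define U where "U i = {x \<in> seq_space n. \<exists>m. Q i m x}" for i
  have U_sets [measurable]: "U i \<in> sets (unif_seq n)" for i
  proof -
    have "{x. Q i m x} \<in> sets (unif_seq n)" for m
      by (rule finite_dependence_sets[of "N i m"]) (rule dep)
    then have "seq_space n \<inter> (\<Union>m. {x. Q i m x}) \<in> sets (unif_seq n)"
      using seq_space_sets by blast
    also have "seq_space n \<inter> (\<Union>m. {x. Q i m x}) = U i" by (auto simp: U_def)
    finally show ?thesis .
  qed
  \<comment> \<open>\<open>k\<close> codes a level i and a string s, \<open>w\<close> a level j > i
    and a witness m. The middle condition says that s is longer than \<open>N j m\<close>, so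
    \<open>Q\<close> meets only genuine entries of s.\<close>
  define P where "P w k \<longleftrightarrow> (fst (prod_decode k) < fst (prod_decode w) \<and>
     code_drop (snd (prod_decode k)) (N (fst (prod_decode w)) (snd (prod_decode w))) \<noteq> 0 \<and>
     Q (fst (prod_decode w)) (snd (prod_decode w)) (code_nth (snd (prod_decode k))))" for w k
  define W where "W = {k. \<exists>w. P w k}"
  have "total_rec 2 (\<lambda>xs. N (fst (prod_decode (xs ! 0))) (snd (prod_decode (xs ! 0))))"
    by (rule total_rec_compose2[OF rec]) (intro rec_intros; simp)+
  moreover have "decidable 2 (\<lambda>xs. Q (fst (prod_decode (xs ! 0))) (snd (prod_decode (xs ! 0)))
      (code_nth (snd (prod_decode (xs ! 1)))))"
    by (rule decidable_compose3[OF dec]) (intro rec_intros; simp)+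
  ultimately have "decidable 2 (\<lambda>xs. P (xs ! 0) (xs ! 1))"
    unfolding P_def by (intro rec_intros) simp_all
  then have ce: "ce_set W" unfolding W_def by (rule ce_set_exists)
  have W: "prod_encode (i, list_encode s) \<in> W \<longleftrightarrow>
      (\<exists>j>i. \<exists>m. N j m < length s \<and> Q j m (code_nth (list_encode s)))" for i s
  proof -
    have "prod_encode (i, list_encode s) \<in> W \<longleftrightarrow> (\<exists>w. P (prod_encode w) (prod_encode (i, list_encode s)))"
      unfolding W_def mem_Collect_eq by (metis prod_decode_inverse)
    also have "\<dots> \<longleftrightarrow> (\<exists>j m. i < j \<and> N j m < length s \<and> Q j m (code_nth (list_encode s)))"
      by (simp add: P_def code_drop_list_encode list_encode_eq_0_iff not_le)
    finally show ?thesis by blast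
  qed
  have open_of: "open_of n W i = (\<Union>j. U (Suc i + j))" for i
  proof (intro equalityI subsetI)
    fix x assume "x \<in> open_of n W i"
    then obtain s j m where *: "x \<in> seq_space n" "x \<in> cyl s" "j > i" "N j m < length s"
        "Q j m (code_nth (list_encode s))"
      unfolding open_of_def W by auto
    have "Q j m x" using *(5)
      by (rule dep[rotated]) (use * in \<open>auto simp: code_nth_list_encode cyl_def\<close>)
    then have "x \<in> U j" using * by (auto simp: U_def)
    moreover have "j = Suc i + (j - Suc i)" using \<open>j > i\<close> by simp
    ultimately show "x \<in> (\<Union>j. U (Suc i + j))" by (metis UN_I UNIV_I)
  next
    fix x assume "x \<in> (\<Union>j. U (Suc i + j))"
    then obtain j0 where "x \<in> U (Suc i + j0)" by blast
    then obtain j m where *: "x \<in> seq_space n" "j > i" "Q j m x"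
      unfolding U_def by (auto intro: that[of "Suc i + j0"])
    \<comment> \<open>One entry more than \<open>Q\<close> reads, because the condition on the
      length is strict.\<close>
    define s where "s = map x [0..<Suc (N j m)]"
    have "Q j m (code_nth (list_encode s))" using *(3)
      by (rule dep[rotated]) (auto simp: code_nth_list_encode s_def simp del: upt_Suc)
    then have "prod_encode (i, list_encode s) \<in> W"
      unfolding W using * by (auto simp: s_def)
    moreover have "x \<in> cyl s" "set s \<subseteq> {..<n}"
      using * by (auto simp: cyl_def s_def seq_space_def simp del: upt_Suc)
    ultimately show "x \<in> open_of n W i" unfolding open_of_def using * by blast
  qed
  \<comment> \<open>The tail starts at level i + 1, so the geometric series adds up to exactly
    \<open>(1/2) ^ i\<close>.\<close>
  have "measure (unif_seq n) (open_of n W i) \<le> (1/2) ^ i" for i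
  proof -
    have sm: "summable (\<lambda>j. (1/2) ^ Suc i * (1/2 :: real) ^ j)" by (intro summable_mult summable_geometric) simp
    have le: "prob (U (Suc i + j)) \<le> (1/2) ^ Suc i * (1/2) ^ j" for j
      using meas[of "Suc i + j"] unfolding U_def power_add .
    have sm': "summable (\<lambda>j. prob (U (Suc i + j)))"
      by (rule summable_comparison_test[OF _ sm]) (use le in \<open>auto simp: power_add intro!: exI[of _ 0]\<close>)
    have "prob (open_of n W i) \<le> (\<Sum>j. prob (U (Suc i + j)))"
      unfolding open_of by (rule finite_measure_subadditive_countably[OF _ sm']) auto
    also have "\<dots> \<le> (\<Sum>j. (1/2) ^ Suc i * (1/2) ^ j)" by (rule suminf_le[OF le sm' sm])
    also have "\<dots> = (1/2) ^ i" by (subst suminf_mult) (auto simp: suminf_geometric)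
    finally show ?thesis .
  qed
  with x ce have "x \<in> seq_space n" "x \<notin> (\<Inter>i. open_of n W i)"
    unfolding mlrandom_def by blast+
  then obtain i where i: "x \<notin> (\<Union>j. U (Suc i + j))" unfolding open_of by blast
  have "\<not> Q k m x" if "k \<ge> Suc i" for k m
  proof
    assume "Q k m x"
    then have "x \<in> U (Suc i + (k - Suc i))" using that \<open>x \<in> seq_space n\<close> by (auto simp: U_def)
    with i show False by blast
  qed
  then show ?thesis by blast
qed

section \<open>Measures determined by their splitting ratios\<close>

declare tail_bits.simps [simp del]

lemma space_cantor: "space cantor = UNIV"
  by (simp add: cantor_def space_PiM)

lemma prob_space_cantor: "prob_space cantor"
  unfolding cantor_def by (intro prob_space_PiM measure_pmf.prob_space_axioms)

lemma measurable_cantor_coord [measurable]: "(\<lambda>y. y i) \<in> cantor \<rightarrow>\<^sub>M count_space UNIV"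
proof -
  have "(\<lambda>x. x i) \<in> cantor \<rightarrow>\<^sub>M measure_pmf (pmf_of_set UNIV)"
    unfolding cantor_def by (rule measurable_component_singleton) simp
  then show ?thesis by simp
qed

lemma cylB_sets [measurable]: "cylB s \<in> sets cantor"
proof -
  have "{x \<in> space cantor. \<forall>i\<in>{..<length s}. x i = s ! i} \<in> sets cantor" by measurable
  then show ?thesis by (simp add: cylB_def space_cantor Ball_def)
qed

lemma cylB_Nil [simp]: "cylB [] = UNIV"
  by (simp add: cylB_def)

lemma cylB_iff_map: "y \<in> cylB s \<longleftrightarrow> map y [0..<length s] = s"
proof
  assume "y \<in> cylB s"
  then show "map y [0..<length s] = s" by (intro nth_equalityI) (auto simp: cylB_def)
next
  assume *: "map y [0..<length s] = s"
  have "y i = s ! i" if "i < length s" for i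
    using arg_cong[OF *, of "\<lambda>s. s ! i"] that by simp
  then show "y \<in> cylB s" by (simp add: cylB_def)
qed

lemma cylB_append: "y \<in> cylB (s @ [b]) \<longleftrightarrow> y \<in> cylB s \<and> y (length s) = b"
  by (simp add: cylB_iff_map)

text \<open>Incompatible strings have disjoint cylinders; with the empty set included the generator
  is closed under intersections, as the uniqueness of measures requires.\<close>

lemma sets_cantor: "sets cantor = sigma_sets UNIV (insert {} (range cylB))"
proof
  show "sigma_sets UNIV (insert {} (range cylB)) \<subseteq> sets cantor"
    using sets.sigma_sets_subset[of "insert {} (range cylB)" cantor] cylB_sets
    by (simp add: space_cantor image_subset_iff)
  have box: "{f. f i \<in> A} \<in> sigma_sets UNIV (insert {} (range cylB))" for i :: nat and A
  proof -
    have "{f. f i \<in> A} = \<Union> (cylB ` {s. length s = Suc i \<and> s ! i \<in> A})"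
    proof (intro equalityI subsetI; clarsimp)
      fix f :: "nat \<Rightarrow> bool" assume "f i \<in> A"
      then show "\<exists>s. length s = Suc i \<and> s ! i \<in> A \<and> f \<in> cylB s"
        by (intro exI[of _ "map f [0..<Suc i]"]) (auto simp: cylB_iff_map nth_append)
    qed (auto simp: cylB_def)
    moreover have "\<Union> (cylB ` {s. length s = Suc i \<and> s ! i \<in> A}) \<in> sigma_sets UNIV (insert {} (range cylB))"
      by (rule sigma_sets_UNION[OF countable_image[OF countableI_type]]) (auto intro: sigma_sets.Basic)
    ultimately show ?thesis by simp
  qed
  have "sets cantor = sigma_sets UNIV {{f. f i \<in> A} | i A. True}"
    unfolding cantor_def by (subst sets_PiM_single) (simp add: PiE_UNIV_domain)
  also have "\<dots> \<subseteq> sigma_sets UNIV (insert {} (range cylB))"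
    by (rule sigma_sets_mono) (auto intro: box)
  finally show "sets cantor \<subseteq> sigma_sets UNIV (insert {} (range cylB))" .
qed

lemma cylB_Int: "cylB s \<inter> cylB t \<in> insert {} (range cylB)"
proof -
  have *: "cylB s \<inter> cylB t = (if take (length s) t = s then cylB t else {})"
    if le: "length s \<le> length t" for s t
  proof (intro equalityI subsetI)
    fix y assume "y \<in> cylB s \<inter> cylB t"
    then show "y \<in> (if take (length s) t = s then cylB t else {})"
      using le by (auto simp: cylB_def intro!: nth_equalityI)
  next
    fix y assume y: "y \<in> (if take (length s) t = s then cylB t else {})"
    then have t: "take (length s) t = s" "y \<in> cylB t" by (auto split: if_splits)
    have "s ! i = t ! i" if "i < length s" for i using t(1) that by (metis nth_take)
    then show "y \<in> cylB s \<inter> cylB t" using t le by (auto simp: cylB_def)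
  qed
  show ?thesis using *[of s t] *[of t s] by (cases "length s \<le> length t") (auto simp: Int_commute)
qed

lemma cantor_measure_eqI:
  assumes "prob_space \<mu>" "prob_space \<nu>" "sets \<mu> = sets cantor" "sets \<nu> = sets cantor"
    and "\<And>s. measure \<mu> (cylB s) = measure \<nu> (cylB s)"
  shows "\<mu> = \<nu>"
proof (rule measure_eqI_generator_eq[where E = "insert {} (range cylB)" and \<Omega> = UNIV and A = "\<lambda>_. UNIV"])
  interpret \<mu>: prob_space \<mu> by fact
  interpret \<nu>: prob_space \<nu> by fact
  show "Int_stable (insert {} (range cylB))"
    using cylB_Int by (auto simp: Int_stable_def)
  show "emeasure \<mu> X = emeasure \<nu> X" if "X \<in> insert {} (range cylB)" for X
    using that assms(5) by (auto simp: \<mu>.emeasure_eq_measure \<nu>.emeasure_eq_measure)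
  show "range (\<lambda>_. UNIV) \<subseteq> insert {} (range cylB)" using cylB_Nil by blast
  show "emeasure \<mu> UNIV \<noteq> \<infinity>" for i :: nat by simp
qed (use assms sets_cantor in auto)

section \<open>Heap numbering of binary strings\<close>

lemma str_index_Nil: "str_index [] = 0"
  by (simp add: str_index_def)

lemma str_index_pos: "0 < foldl (\<lambda>a b. 2 * a + (if b then 1 else 0)) (1::nat) (s :: bool list)"
  by (induction s rule: rev_induct) auto

text \<open>This is the numbering of a binary heap; it turns walks in the tree into arithmetic on
  indices.\<close>

lemma str_index_snoc: "str_index (s @ [b]) = 2 * str_index s + 1 + (if b then 1 else 0)"
  using str_index_pos[of s] by (simp add: str_index_def)

lemma sigma_str_index: "sigma (str_index s) = s"
proof (induction s rule: rev_induct)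
  case Nil show ?case by (simp add: str_index_Nil sigma_def tail_bits.simps)
next
  case (snoc b s)
  then show ?case
    by (simp add: str_index_snoc sigma_def tail_bits.simps[of "Suc (Suc _)"])
qed

lemma str_index_sigma: "str_index (sigma n) = n"
proof (induction n rule: less_induct)
  case (less n)
  show ?case
  proof (cases "n = 0")
    case True then show ?thesis by (simp add: sigma_def tail_bits.simps str_index_Nil)
  next
    case False
    define m where "m = Suc n div 2 - 1"
    have m: "Suc m = Suc n div 2" "m < n" using False by (auto simp: m_def)
    have "sigma n = sigma m @ [odd (Suc n)]"
      using False m by (simp add: sigma_def tail_bits.simps[of "Suc n"])
    then have "str_index (sigma n) = 2 * m + 1 + (if odd (Suc n) then 1 else 0)"
      using less[OF m(2)] by (simp add: str_index_snoc del: even_Suc)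
    also have "\<dots> = n" using m(1) False by presburger
    finally show ?thesis .
  qed
qed

fun path_prefix :: "(nat \<Rightarrow> real) \<Rightarrow> (nat \<Rightarrow> real) \<Rightarrow> nat \<Rightarrow> bool list" where
  "path_prefix c u 0 = []"
| "path_prefix c u (Suc k) = path_prefix c u k @ [\<not> u k < c (str_index (path_prefix c u k))]"

lemma path_prefix_dep: "(\<And>j. j < k \<Longrightarrow> u j = v j) \<Longrightarrow> path_prefix c u k = path_prefix c v k"
  by (induction k) auto

text \<open>Descend the binary tree, moving from a node with index \<open>n\<close> to its left child iff a fresh
  uniform real is below \<open>c n\<close>; the required measure is the distribution of the path.\<close>
lemma exists_splitting_measure:
  assumes c: "\<And>n. 0 \<le> c n" "\<And>n. c n \<le> (1::real)"
  shows "\<exists>\<mu>. prob_space \<mu> \<and> sets \<mu> = sets cantor \<and>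
      (\<forall>n. measure \<mu> (cylB (sigma n @ [False])) = c n * measure \<mu> (cylB (sigma n)))"
proof -
  define N where "N = uniform_measure lborel {0..1::real}"
  have N: "prob_space N" unfolding N_def by (rule prob_space_uniform_measure) auto
  have N_sets [measurable_cong]: "sets N = sets borel" by (simp add: N_def)
  have N_less: "measure N {..<t} = t" if "0 \<le> t" "t \<le> 1" for t
  proof -
    have "{0..1} \<inter> {..<t} = {0..<t}" using that by auto
    then show ?thesis using that unfolding N_def by (subst measure_uniform_measure) auto
  qed
  define \<Omega> where "\<Omega> = PiM UNIV (\<lambda>_::nat. N)"
  have space: "space \<Omega> = UNIV"
    using sets_eq_imp_space_eq[OF N_sets] by (simp add: \<Omega>_def space_PiM)
  interpret \<Omega>: prob_space \<Omega> unfolding \<Omega>_def by (intro prob_space_PiM N)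
  have coord [measurable]: "(\<lambda>u. u i) \<in> borel_measurable \<Omega>" for i
  proof -
    have "(\<lambda>u. u i) \<in> \<Omega> \<rightarrow>\<^sub>M N" unfolding \<Omega>_def by (rule measurable_component_singleton) simp
    then show ?thesis by (simp cong: measurable_cong_sets add: N_sets)
  qed
  have pre [measurable]: "(\<lambda>u. path_prefix c u k) \<in> \<Omega> \<rightarrow>\<^sub>M count_space UNIV" for k
  proof (induction k)
    case (Suc k)
    note [measurable] = Suc
    have "(\<lambda>u. c (str_index (path_prefix c u k))) \<in> borel_measurable \<Omega>"
      by (rule measurable_compose[OF Suc]) simp
    then have "Measurable.pred \<Omega> (\<lambda>u. u k < c (str_index (path_prefix c u k)))" by measurable
    then show ?case by simp
  qed simp
  define path where "path u k = (\<not> u k < c (str_index (path_prefix c u k)))" for u k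
  have map_path: "map (path u) [0..<k] = path_prefix c u k" for u k
    by (induction k) (auto simp: path_def)
  have path_eq: "(\<lambda>u. path u i) = (\<lambda>u. last (path_prefix c u (Suc i)))" for i
    by (simp add: path_def)
  have path: "path \<in> \<Omega> \<rightarrow>\<^sub>M cantor"
    unfolding cantor_def
  proof (rule measurable_PiM_single')
    show "(\<lambda>u. path u i) \<in> \<Omega> \<rightarrow>\<^sub>M measure_pmf (pmf_of_set UNIV)" for i
      unfolding path_eq using measurable_compose[OF pre[of "Suc i"], of last "count_space UNIV"]
      by (simp del: path_prefix.simps)
  qed auto
  define \<mu> where "\<mu> = distr \<Omega> cantor path"
  have cyl: "measure \<mu> (cylB s) = \<Omega>.prob {u. path_prefix c u (length s) = s}" for s
    unfolding \<mu>_def by (subst measure_distr[OF path]) (auto simp: space cylB_iff_map map_path vimage_def)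
  have "measure \<mu> (cylB (s @ [False])) = c (str_index s) * measure \<mu> (cylB s)" for s
  proof -
    let ?f = "indicator {u. path_prefix c u (length s) = s} :: _ \<Rightarrow> real"
    let ?g = "indicator {u. u (length s) < c (str_index s)} :: _ \<Rightarrow> real"
    have A: "{u. path_prefix c u (length s) = s} \<in> sets \<Omega>"
      using measurable_sets[OF pre[of "length s"], of "{s}"] by (simp add: space vimage_def)
    have B: "{u. u (length s) < c (str_index s)} \<in> sets \<Omega>"
      using measurable_sets[OF coord[of "length s"], of "{..<c (str_index s)}"] by (simp add: space vimage_def)
    have "\<Omega>.prob {u. u (length s) < c (str_index s)} = measure (distr \<Omega> N (\<lambda>u. u (length s))) {..<c (str_index s)}"
      by (subst measure_distr) (auto simp: space vimage_def measurable_cong_sets[OF refl N_sets])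
    also have "distr \<Omega> N (\<lambda>u. u (length s)) = N"
      unfolding \<Omega>_def using distr_PiM_component[of UNIV "\<lambda>_. N"] N by simp
    finally have g: "\<Omega>.prob {u. u (length s) < c (str_index s)} = c (str_index s)"
      using N_less c by simp
    have "{u. path_prefix c u (length (s @ [False])) = s @ [False]} =
        {u. path_prefix c u (length s) = s} \<inter> {u. u (length s) < c (str_index s)}"
      by auto
    then have "measure \<mu> (cylB (s @ [False])) = (\<integral>u. ?f u * ?g u \<partial>\<Omega>)"
      unfolding cyl by (simp add: indicator_inter_arith[symmetric] space A B)
    \<comment> \<open>The first \<open>length s\<close> turns read only earlier reals and the next
      turn only the fresh one, so the two events are independent.\<close>
    also have "\<dots> = (\<integral>u. ?f u \<partial>\<Omega>) * (\<integral>u. ?g u \<partial>\<Omega>)"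
      unfolding \<Omega>_def
    proof (rule integral_PiM_mult[OF N, where J = "{..<length s}" and K = "{length s}" and B = 1 and C = 1])
      show "?f u = ?f v" if "\<And>j. j \<in> {..<length s} \<Longrightarrow> u j = v j" for u v
        using path_prefix_dep[of "length s" u v c] that by (simp add: indicator_def)
    qed (use A B in \<open>auto simp: \<Omega>_def[symmetric] indicator_def\<close>)
    also have "\<dots> = c (str_index s) * measure \<mu> (cylB s)"
      by (simp add: space A B g cyl)
    finally show ?thesis .
  qed
  then have "measure \<mu> (cylB (sigma n @ [False])) = c n * measure \<mu> (cylB (sigma n))" for n
    by (metis str_index_sigma)
  moreover have "prob_space \<mu>" unfolding \<mu>_def by (rule \<Omega>.prob_space_distr[OF path])
  moreover have "sets \<mu> = sets cantor" by (simp add: \<mu>_def)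
  ultimately show ?thesis by blast
qed

lemma measure_cylB_snoc:
  assumes "prob_space \<mu>" "sets \<mu> = sets cantor"
  shows "measure \<mu> (cylB (s @ [True])) = measure \<mu> (cylB s) - measure \<mu> (cylB (s @ [False]))"
proof -
  interpret prob_space \<mu> by fact
  have "cylB s = cylB (s @ [True]) \<union> cylB (s @ [False])"
    by (auto simp: cylB_append)
  moreover have "cylB (s @ [True]) \<inter> cylB (s @ [False]) = {}" by (auto simp: cylB_append)
  ultimately have "measure \<mu> (cylB s) = measure \<mu> (cylB (s @ [True])) + measure \<mu> (cylB (s @ [False]))"
    using finite_measure_Union[of "cylB (s @ [True])" "cylB (s @ [False])"] assms(2) by simp
  then show ?thesis by simp
qed

lemma splitting_measure_unique:
  assumes "prob_space \<mu>" "sets \<mu> = sets cantor"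
      "\<And>n. measure \<mu> (cylB (sigma n @ [False])) = c n * measure \<mu> (cylB (sigma n))"
    and "prob_space \<nu>" "sets \<nu> = sets cantor"
      "\<And>n. measure \<nu> (cylB (sigma n @ [False])) = c n * measure \<nu> (cylB (sigma n))"
  shows "\<mu> = \<nu>"
proof (rule cantor_measure_eqI[OF assms(1,4,2,5)])
  show "measure \<mu> (cylB s) = measure \<nu> (cylB s)" for s
  proof (induction s rule: rev_induct)
    case Nil
    have "space \<mu> = UNIV" "space \<nu> = UNIV"
      using assms(2,5) by (auto dest!: sets_eq_imp_space_eq simp: space_cantor)
    then show ?case
      using prob_space.prob_space[OF assms(1)] prob_space.prob_space[OF assms(4)] by simp
  next
    case (snoc b s)
    have "measure \<mu> (cylB (s @ [False])) = measure \<nu> (cylB (s @ [False]))"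
      using assms(3,6)[of "str_index s"] snoc by (simp add: sigma_str_index)
    then show ?case
      using measure_cylB_snoc[OF assms(1,2)] measure_cylB_snoc[OF assms(4,5)] snoc by (cases b) auto
  qed
qed

lemma summable_column:
  assumes "x \<in> seq_space 2"
  shows "summable (\<lambda>k. real (x (prod_encode (n, k))) * (1/2) ^ Suc k)"
proof (rule summable_comparison_test')
  show "summable (\<lambda>k. (1/2 :: real) ^ Suc k)" by (subst summable_Suc_iff) (rule summable_geometric, simp)
  show "norm (real (x (prod_encode (n, k))) * (1/2) ^ Suc k) \<le> (1/2) ^ Suc k" if "0 \<le> k" for k
  proof -
    have "x (prod_encode (n, k)) \<le> 1" using assms by (auto simp: seq_space_def less_Suc_eq_le numeral_2_eq_2)
    then show ?thesis by (simp add: mult_le_cancel_right1)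
  qed
qed

lemma column_split:
  assumes "x \<in> seq_space 2"
  shows "(\<Sum>k<N. real (x (prod_encode (n, k))) * (1/2) ^ Suc k) \<le> column x n"
    and "column x n \<le> (\<Sum>k<N. real (x (prod_encode (n, k))) * (1/2) ^ Suc k) + (1/2) ^ N"
proof -
  let ?f = "\<lambda>k. real (x (prod_encode (n, k))) * (1/2) ^ Suc k"
  have bit: "x (prod_encode (n, k)) \<le> 1" for k
    using assms by (auto simp: seq_space_def less_Suc_eq_le numeral_2_eq_2)
  have col: "column x n = (\<Sum>k. ?f (k + N)) + (\<Sum>k<N. ?f k)"
    unfolding column_def by (rule suminf_split_initial_segment[OF summable_column[OF assms]])
  have sm: "summable (\<lambda>k. ?f (k + N))"
    using summable_column[OF assms, of n] by (subst summable_iff_shift)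
  then have "0 \<le> (\<Sum>k. ?f (k + N))" by (rule suminf_nonneg) simp
  then show "(\<Sum>k<N. ?f k) \<le> column x n" unfolding col by simp
  have g: "(\<lambda>k. (1/2) ^ Suc N * (1/2 :: real) ^ k) sums ((1/2) ^ Suc N * (1 / (1 - 1/2)))"
    by (intro sums_mult geometric_sums) simp
  have "?f (k + N) \<le> (1/2) ^ Suc N * (1/2) ^ k" for k
    using bit[of "k + N"] by (simp add: power_add mult_le_cancel_right1 mult.commute)
  then have "(\<Sum>k. ?f (k + N)) \<le> (\<Sum>k. (1/2) ^ Suc N * (1/2) ^ k)"
    by (rule suminf_le[OF _ sm sums_summable[OF g]])
  also have "\<dots> = (1/2) ^ N" using sums_unique[OF g] by simp
  finally show "column x n \<le> (\<Sum>k<N. ?f k) + (1/2) ^ N" unfolding col by simp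
qed

text \<open>Legitimises the definite description: the random path gives existence, induction on
  strings gives uniqueness.\<close>

lemma mu_of:
  assumes "x \<in> seq_space 2"
  shows "prob_space (mu_of x)" "sets (mu_of x) = sets cantor"
    "measure (mu_of x) (cylB (s @ [False])) = column x (str_index s) * measure (mu_of x) (cylB s)"
    "measure (mu_of x) (cylB (s @ [True])) = (1 - column x (str_index s)) * measure (mu_of x) (cylB s)"
proof -
  let ?P = "\<lambda>\<mu>. prob_space \<mu> \<and> sets \<mu> = sets cantor \<and>
      (\<forall>n. measure \<mu> (cylB (sigma n @ [False])) = column x n * measure \<mu> (cylB (sigma n)))"
  have "\<exists>\<mu>. ?P \<mu>"
    \<comment> \<open>With \<open>N = 0\<close>, \<open>column_split\<close> says that the column
      lies between 0 and 1.\<close>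
    by (rule exists_splitting_measure) (use column_split[OF assms, where N = 0] in simp_all)
  then have "\<exists>!\<mu>. ?P \<mu>"
    by (metis (no_types, lifting) splitting_measure_unique[of _ "column x"])
  then have P: "?P (mu_of x)" unfolding mu_of_def by (rule theI')
  then show p: "prob_space (mu_of x)" "sets (mu_of x) = sets cantor" by auto
  show F: "measure (mu_of x) (cylB (s @ [False])) = column x (str_index s) * measure (mu_of x) (cylB s)"
    using P by (metis sigma_str_index)
  show "measure (mu_of x) (cylB (s @ [True])) = (1 - column x (str_index s)) * measure (mu_of x) (cylB s)"
    using measure_cylB_snoc[OF p, of s] F by (simp add: algebra_simps)
qed

section \<open>Heavy cylinders of random measures\<close>

text \<open>Bits are compared through being equal to 1, since the space contains all sequences of
  naturals. That way the expansion over bit patterns in \<open>integral_three_coords\<close> holds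
  at every point, not just almost everywhere.\<close>

lemma integral_coord_indicator:
  assumes "p = 0 \<or> p = (1::nat)"
  shows "(\<integral>z. of_bool ((z k = 1) = (p = 1)) \<partial>unif_seq 2) = (1/2 :: real)"
proof -
  let ?N = "measure_pmf (pmf_of_set {..<2::nat})"
  have "(\<integral>z. of_bool ((z k = 1) = (p = 1)) \<partial>unif_seq 2 :: real)
      = (\<integral>j. of_bool ((j = 1) = (p = 1)) \<partial>distr (unif_seq 2) ?N (\<lambda>z. z k))"
    unfolding unif_seq_def by (subst integral_distr) auto
  also have "distr (unif_seq 2) ?N (\<lambda>z. z k) = ?N"
    unfolding unif_seq_def
    by (rule distr_PiM_component) (auto intro: measure_pmf.prob_space_axioms)
  also have "(\<integral>j. of_bool ((j = 1) = (p = 1)) \<partial>?N) = (1/2 :: real)"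
    using assms by (subst integral_pmf_of_set) (auto simp: lessThan_nat_numeral lessThan_Suc numeral_2_eq_2)
  finally show ?thesis .
qed

lemma borel_measurable_unif_seq:
  fixes f :: "(nat \<Rightarrow> nat) \<Rightarrow> real"
  assumes "\<And>x y. (\<And>j. j < N \<Longrightarrow> x j = y j) \<Longrightarrow> f x = f y"
  shows "f \<in> borel_measurable (unif_seq n)"
proof (rule measurableI)
  fix A :: "real set" assume "A \<in> sets borel"
  have "{x. f x \<in> A} \<in> sets (unif_seq n)"
    by (rule finite_dependence_sets[of N]) (use assms in metis)
  then show "f -` A \<inter> space (unif_seq n) \<in> sets (unif_seq n)"
    by (simp add: space_unif_seq vimage_def)
qed simp

lemma unif_seq_mult:
  fixes f g :: "(nat \<Rightarrow> nat) \<Rightarrow> real"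
  assumes "f \<in> borel_measurable (unif_seq n)" "g \<in> borel_measurable (unif_seq n)"
    and "\<And>x. \<bar>f x\<bar> \<le> B" "\<And>x. \<bar>g x\<bar> \<le> C"
    and "\<And>x y. (\<And>j. j \<in> J \<Longrightarrow> x j = y j) \<Longrightarrow> f x = f y"
    and "\<And>x y. (\<And>j. j \<in> K \<Longrightarrow> x j = y j) \<Longrightarrow> g x = g y"
    and "J \<inter> K = {}"
  shows "(\<integral>x. f x * g x \<partial>unif_seq n) = (\<integral>x. f x \<partial>unif_seq n) * (\<integral>x. g x \<partial>unif_seq n)"
  unfolding unif_seq_def
  by (rule integral_PiM_mult[OF measure_pmf.prob_space_axioms assms[unfolded unif_seq_def]])

lemma integral_three_coords:
  fixes \<phi> :: "nat \<Rightarrow> nat \<Rightarrow> nat \<Rightarrow> real"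
  assumes "i \<noteq> j" "i \<noteq> k" "j \<noteq> k"
  shows "(\<integral>z. \<phi> (of_bool (z i = 1)) (of_bool (z j = 1)) (of_bool (z k = 1)) \<partial>unif_seq 2)
     = (\<Sum>a\<in>{0,1}. \<Sum>b\<in>{0,1}. \<Sum>c\<in>{0,1}. \<phi> a b c) / 8"
proof -
  interpret prob_space "unif_seq 2" by (rule prob_space_unif_seq)
  let ?I = "\<lambda>k p z. of_bool ((z k = (1::nat)) = (p = (1::nat))) :: real"
  have meas: "?I k p \<in> borel_measurable (unif_seq 2)" for k p
    by (rule borel_measurable_unif_seq[of "Suc k"]) simp
  have meas2: "(\<lambda>z. ?I j b z * ?I k c z) \<in> borel_measurable (unif_seq 2)" for b c
    by (intro borel_measurable_times meas)
  have E: "(\<integral>z. ?I i a z * (?I j b z * ?I k c z) \<partial>unif_seq 2) = 1/8"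
    if "a \<in> {0,1}" "b \<in> {0,1}" "c \<in> {0,1}" for a b c
  proof -
    have "(\<integral>z. ?I i a z * (?I j b z * ?I k c z) \<partial>unif_seq 2) =
        (\<integral>z. ?I i a z \<partial>unif_seq 2) * (\<integral>z. ?I j b z * ?I k c z \<partial>unif_seq 2)"
      by (rule unif_seq_mult[where J = "{i}" and K = "{j,k}" and B = 1 and C = 1])
         (use assms meas meas2 in auto)
    also have "(\<integral>z. ?I j b z * ?I k c z \<partial>unif_seq 2) =
        (\<integral>z. ?I j b z \<partial>unif_seq 2) * (\<integral>z. ?I k c z \<partial>unif_seq 2)"
      by (rule unif_seq_mult[where J = "{j}" and K = "{k}" and B = 1 and C = 1])
         (use assms meas in auto)
    finally show ?thesis
      using that by (subst (asm) (1 2 3) integral_coord_indicator) auto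
  qed
  have int: "integrable (unif_seq 2) (\<lambda>z. ?I i a z * (?I j b z * ?I k c z))" for a b c
    by (rule integrable_const_bound[of _ 1]) (use meas meas2 in auto)
  have "(\<integral>z. \<phi> (of_bool (z i = 1)) (of_bool (z j = 1)) (of_bool (z k = 1)) \<partial>unif_seq 2)
     = (\<integral>z. (\<Sum>a\<in>{0,1}. \<Sum>b\<in>{0,1}. \<Sum>c\<in>{0,1}. \<phi> a b c * (?I i a z * (?I j b z * ?I k c z))) \<partial>unif_seq 2)"
    by (intro Bochner_Integration.integral_cong refl) auto
  also have "\<dots> = (\<Sum>a\<in>{0,1}. \<Sum>b\<in>{0,1}. \<Sum>c\<in>{0,1}. \<phi> a b c * (1/8))"
    by (simp only: Bochner_Integration.integral_sum Bochner_Integration.integrable_sum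
        integrable_mult_right int integral_mult_right_zero E cong: sum.cong)
  finally show ?thesis by simp
qed

text \<open>Eight times the column cut off after three bits. Testing for 1 confines the value to 0,
  ..., 7 even off \<open>seq_space 2\<close>.\<close>

definition lead_bits :: "(nat \<Rightarrow> nat) \<Rightarrow> nat \<Rightarrow> nat" where
  "lead_bits z v = 4 * of_bool (z (prod_encode (v, 0)) = 1) + 2 * of_bool (z (prod_encode (v, 1)) = 1)
     + of_bool (z (prod_encode (v, 2)) = 1)"

text \<open>The column is the share of the left child, so a leading bit 0 sends the path to the
  right.\<close>

definition heavy_child :: "(nat \<Rightarrow> nat) \<Rightarrow> nat \<Rightarrow> bool" where
  "heavy_child z v = (lead_bits z v < 4)"

text \<open>Eighths of a lower bound for the share of the child with the larger mass, read off the
  first three bits of the column.\<close>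
definition heavy_weight :: "(nat \<Rightarrow> nat) \<Rightarrow> nat \<Rightarrow> nat" where
  "heavy_weight z v = (if lead_bits z v < 4 then 7 - lead_bits z v else lead_bits z v)"

text \<open>The start 2 is \<open>str_index [True]\<close> and the step is that of
  \<open>str_index_snoc\<close>. The form as a primitive recursion lets
  \<open>total_rec_recursion\<close> apply.\<close>

definition heavy_node :: "(nat \<Rightarrow> nat) \<Rightarrow> nat \<Rightarrow> nat" where
  "heavy_node z k = rec_nat 2 (\<lambda>_ v. 2 * v + 1 + (if heavy_child z v then 1 else 0)) k"

definition heavy_product :: "(nat \<Rightarrow> nat) \<Rightarrow> nat \<Rightarrow> nat" where
  "heavy_product z n = rec_nat 1 (\<lambda>k p. p * heavy_weight z (heavy_node z k)) n"

lemma heavy_node_simps [simp]: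
  "heavy_node z 0 = 2"
  "heavy_node z (Suc k) = 2 * heavy_node z k + 1 + (if heavy_child z (heavy_node z k) then 1 else 0)"
  by (simp_all add: heavy_node_def)

lemma heavy_product_simps [simp]:
  "heavy_product z 0 = 1"
  "heavy_product z (Suc n) = heavy_product z n * heavy_weight z (heavy_node z n)"
  by (simp_all add: heavy_product_def)

lemma heavy_weight_ge: "4 \<le> heavy_weight z v"
  by (auto simp: heavy_weight_def)

lemma heavy_product_ge: "4 ^ n \<le> heavy_product z n"
  by (induction n) (auto simp: mult.commute[of 4] intro!: mult_le_mono heavy_weight_ge)

lemma heavy_product_pos: "0 < heavy_product z n"
  using heavy_product_ge[of n z] by (rule less_le_trans[rotated]) simp

lemma heavy_node_less: "heavy_node z k < 4 * 2 ^ k"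
proof -
  have "heavy_node z k + 2 \<le> 4 * 2 ^ k" by (induction k) auto
  then show ?thesis by simp
qed

lemma heavy_node_strict_mono: "j < k \<Longrightarrow> heavy_node z j < heavy_node z k"
  by (rule lift_Suc_mono_less[of "heavy_node z"]) auto

lemma lead_bits_cong:
  "(\<And>j. j < 3 \<Longrightarrow> x (prod_encode (v, j)) = y (prod_encode (v, j))) \<Longrightarrow> lead_bits x v = lead_bits y v"
  by (simp add: lead_bits_def)

text \<open>Indices increase along the path, so the first \<open>n\<close> steps consult only
  columns with index below the node reached. Bounding by that node, and not by a uniform constant,
  is what separates past from present in the expectation.\<close>

lemma heavy_node_cong:
  assumes "\<And>v j. v < heavy_node x n \<Longrightarrow> j < 3 \<Longrightarrow> x (prod_encode (v, j)) = y (prod_encode (v, j))"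
  shows "k \<le> n \<Longrightarrow> heavy_node y k = heavy_node x k"
    and "k \<le> n \<Longrightarrow> heavy_product y k = heavy_product x k"
proof (induction k)
  case (Suc k)
  {
    assume k: "Suc k \<le> n"
    have "heavy_node x k < heavy_node x n" using k by (intro heavy_node_strict_mono) simp
    then have "lead_bits y (heavy_node x k) = lead_bits x (heavy_node x k)"
      by (intro lead_bits_cong) (simp add: assms)
    then have "heavy_node y (Suc k) = heavy_node x (Suc k) \<and> heavy_product y (Suc k) = heavy_product x (Suc k)"
      using Suc.IH k by (auto simp: heavy_child_def heavy_weight_def)
  }
  then show "Suc k \<le> n \<Longrightarrow> heavy_node y (Suc k) = heavy_node x (Suc k)"
    "Suc k \<le> n \<Longrightarrow> heavy_product y (Suc k) = heavy_product x (Suc k)"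
    by auto
qed simp_all

lemma integral_heavy_weight: "(\<integral>z. 8 / real (heavy_weight z v) \<partial>unif_seq 2) = 319/210"
proof -
  let ?w = "\<lambda>a b c. if 4*a + 2*b + c < (4::nat) then 7 - (4*a + 2*b + c) else 4*a + 2*b + c"
  have "(\<integral>z. 8 / real (heavy_weight z v) \<partial>unif_seq 2) =
     (\<Sum>a\<in>{0,1}. \<Sum>b\<in>{0,1}. \<Sum>c\<in>{0,1}. 8 / real (?w a b c)) / 8"
    unfolding heavy_weight_def lead_bits_def
    by (rule integral_three_coords[where \<phi> = "\<lambda>a b c. 8 / real (?w a b c)"]) simp_all
  \<comment> \<open>Each of the weights 4, 5, 6, 7 occurs for two of the eight patterns, which gives
    \<open>2 * (1/4 + 1/5 + 1/6 + 1/7)\<close>.\<close>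
  also have "\<dots> = 319/210" by simp
  finally show ?thesis .
qed

text \<open>Which column is read next depends on earlier bits, so the factors do not sit at fixed
  coordinates. Splitting by the node v reached after n steps repairs this: the past reads columns
  below v, the next weight reads column v, and its reciprocal has the same expectation for every
  v.\<close>

lemma integral_heavy_product: 
  "(\<integral>z. 8 ^ n / real (heavy_product z n) \<partial>unif_seq 2) = (319/210) ^ n"
proof (induction n)
  case 0
  interpret prob_space "unif_seq 2" by (rule prob_space_unif_seq)
  show ?case using prob_space by simp
next
  case (Suc n)
  interpret prob_space "unif_seq 2" by (rule prob_space_unif_seq)
  let ?f = "\<lambda>v z. if heavy_node z n = v then 8 ^ n / real (heavy_product z n) else 0"
  let ?g = "\<lambda>v z. 8 / real (heavy_weight z v)"
  let ?J = "\<lambda>v. {prod_encode (u, j) | u j. u < v \<and> j < (3::nat)}"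
  have J: "\<exists>N. \<forall>j\<in>?J v. j < N" for v
  proof -
    have "?J v = prod_encode ` ({..<v} \<times> {..<3})" by auto
    then have "finite (?J v)" by simp
    then show ?thesis by (meson finite_nat_set_iff_bounded)
  qed
  have f_dep: "?f v x = ?f v y" if "\<And>j. j \<in> ?J v \<Longrightarrow> x j = y j" for v x y
  proof -
    have "?f v x = ?f v y" if "heavy_node x n = v" "\<And>j. j \<in> ?J v \<Longrightarrow> x j = y j" for x y
    proof -
      have "heavy_node y n = heavy_node x n" "heavy_product y n = heavy_product x n"
        using that by (auto intro!: heavy_node_cong[where n = n])
      then show ?thesis by simp
    qed
    from this[of x y] this[of y x] that show ?thesis by (metis (no_types, lifting))
  qed
  have g_dep: "?g v x = ?g v y" if "\<And>j. j \<in> {prod_encode (v, j) | j. j < 3} \<Longrightarrow> x j = y j" for v x y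
    using lead_bits_cong[of x v y] that by (auto simp: heavy_weight_def)
  have f_meas: "?f v \<in> borel_measurable (unif_seq 2)" for v
  proof -
    obtain N where "\<forall>j\<in>?J v. j < N" using J by blast
    then show ?thesis using f_dep by (intro borel_measurable_unif_seq[of N]) blast
  qed
  have g_meas: "?g v \<in> borel_measurable (unif_seq 2)" for v
  proof -
    obtain N where "\<forall>j\<in>?J (Suc v). j < N" using J by blast
    then show ?thesis by (intro borel_measurable_unif_seq[of N] g_dep) blast
  qed
  have f_bd: "\<bar>?f v z\<bar> \<le> 2 ^ n" for v z
  proof -
    have "(4::real) ^ n \<le> real (heavy_product z n)"
      using heavy_product_ge[of n z] by (metis of_nat_le_iff of_nat_numeral of_nat_power)
    then have "8 ^ n / real (heavy_product z n) \<le> 8 ^ n / 4 ^ n"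
      by (intro divide_left_mono mult_pos_pos) (simp_all add: heavy_product_pos)
    also have "\<dots> = 2 ^ n" by (simp flip: power_divide)
    finally show ?thesis by simp
  qed
  have g_bd: "\<bar>?g v z\<bar> \<le> 2" for v z
    using heavy_weight_ge[of z v] by (simp add: field_simps)
  have fg: "(\<integral>z. ?f v z * ?g v z \<partial>unif_seq 2) = (\<integral>z. ?f v z \<partial>unif_seq 2) * (319/210)" for v
    unfolding integral_heavy_weight[of v, symmetric]
  proof (rule unif_seq_mult[OF f_meas g_meas f_bd g_bd])
    show "?f v x = ?f v y" if "\<And>j. j \<in> ?J v \<Longrightarrow> x j = y j" for x y by (rule f_dep[OF that])
    show "?g v x = ?g v y" if "\<And>j. j \<in> {prod_encode (v, j) | j. j < 3} \<Longrightarrow> x j = y j" for x y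
      by (rule g_dep[OF that])
  qed (auto simp: prod_encode_eq)
  have int_f: "integrable (unif_seq 2) (?f v)" for v
    by (rule integrable_const_bound[OF AE_I2 f_meas, where B = "2 ^ n"]) (use f_bd in simp)
  have int_fg: "integrable (unif_seq 2) (\<lambda>z. ?f v z * ?g v z)" for v
  proof (rule integrable_const_bound)
    show "AE z in unif_seq 2. norm (?f v z * ?g v z) \<le> 2 ^ n * 2"
      unfolding real_norm_def abs_mult by (intro AE_I2 mult_mono f_bd g_bd) auto
  qed (intro borel_measurable_times f_meas g_meas)
  have "(\<integral>z. 8 ^ Suc n / real (heavy_product z (Suc n)) \<partial>unif_seq 2) =
      (\<integral>z. (\<Sum>v<4 * 2 ^ n. ?f v z * ?g v z) \<partial>unif_seq 2)"
  proof (intro Bochner_Integration.integral_cong refl)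
    fix z
    have "(\<Sum>v<4 * 2 ^ n. ?f v z * ?g v z) =
        (\<Sum>v<4 * 2 ^ n. if heavy_node z n = v then 8 ^ n / real (heavy_product z n) * ?g v z else 0)"
      by (intro sum.cong) auto
    then show "8 ^ Suc n / real (heavy_product z (Suc n)) = (\<Sum>v<4 * 2 ^ n. ?f v z * ?g v z)"
      using heavy_node_less[of z n] by simp
  qed
  also have "\<dots> = (\<Sum>v<4 * 2 ^ n. (\<integral>z. ?f v z \<partial>unif_seq 2)) * (319/210)"
    by (subst Bochner_Integration.integral_sum[OF int_fg]) (simp only: fg sum_distrib_right)
  also have "(\<Sum>v<4 * 2 ^ n. (\<integral>z. ?f v z \<partial>unif_seq 2)) = (\<integral>z. (\<Sum>v<4 * 2 ^ n. ?f v z) \<partial>unif_seq 2)"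
    by (rule Bochner_Integration.integral_sum[OF int_f, symmetric])
  also have "\<dots> = (\<integral>z. 8 ^ n / real (heavy_product z n) \<partial>unif_seq 2)"
    using heavy_node_less[of _ n] by (intro Bochner_Integration.integral_cong refl) simp
  finally show ?case using Suc by simp
qed

lemma prod_encode_less: "u < v \<Longrightarrow> i \<le> j \<Longrightarrow> prod_encode (u, i) < prod_encode (v, j)"
proof -
  assume "u < v" "i \<le> j"
  then have "triangle (u + i) \<le> triangle (v + j)"
    unfolding triangle_def by (intro div_le_mono mult_le_mono) auto
  then show ?thesis using \<open>u < v\<close> by (simp add: prod_encode_def)
qed

lemma heavy_product_cong:
  assumes "\<And>j. j < prod_encode (4 * 2 ^ n, 3) \<Longrightarrow> x j = y j"
  shows "heavy_product x n = heavy_product y n"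
proof (rule heavy_node_cong(2)[of y n x n, OF _ order_refl])
  fix v j :: nat assume "v < heavy_node y n" "j < 3"
  then have "prod_encode (v, j) < prod_encode (4 * 2 ^ n, 3)"
    using heavy_node_less[of y n] by (intro prod_encode_less) auto
  then show "y (prod_encode (v, j)) = x (prod_encode (v, j))" using assms by simp
qed

text \<open>The event is an inequality between naturals, hence decidable; divided by
  \<open>20 ^ n * 8 ^ n\<close> it says that the product of the guaranteed shares is at most
  \<open>(13/20) ^ n\<close>. Markov's inequality is applied to the reciprocal of that
  product.\<close>

lemma measure_heavy_product_le:
  "measure (unif_seq 2) {z \<in> seq_space 2. heavy_product z (60 * i) * 20 ^ (60 * i) \<le> 13 ^ (60 * i) * 8 ^ (60 * i)}
     \<le> (1/2) ^ i"
proof -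
  interpret prob_space "unif_seq 2" by (rule prob_space_unif_seq)
  define n where "n = 60 * i"
  let ?u = "\<lambda>z. 8 ^ n / real (heavy_product z n)"
  have meas: "?u \<in> borel_measurable (unif_seq 2)"
    by (rule borel_measurable_unif_seq[of "prod_encode (4 * 2 ^ n, 3)"]) 
      (rule arg_cong[where f = "\<lambda>p. 8 ^ n / real p"], rule heavy_product_cong, simp)
  have ge: "(4::real) ^ n \<le> real (heavy_product z n)" for z
    using heavy_product_ge[of n z] by (metis of_nat_le_iff of_nat_numeral of_nat_power)
  have pos: "0 < real (heavy_product z n)" for z by (simp add: heavy_product_pos)
  have int: "integrable (unif_seq 2) ?u"
  proof (rule integrable_const_bound[OF _ meas])
    show "AE z in unif_seq 2. norm (?u z) \<le> 8 ^ n / 4 ^ n"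
      by (intro AE_I2) (auto intro!: divide_left_mono ge mult_pos_pos pos)
  qed
  have "prob {z \<in> seq_space 2. heavy_product z n * 20 ^ n \<le> 13 ^ n * 8 ^ n}
      \<le> prob {z \<in> space (unif_seq 2). ?u z \<ge> (20/13) ^ n}"
  proof (rule finite_measure_mono)
    show "{z \<in> seq_space 2. heavy_product z n * 20 ^ n \<le> 13 ^ n * 8 ^ n} \<subseteq> {z \<in> space (unif_seq 2). ?u z \<ge> (20/13) ^ n}"
    proof (clarsimp simp: space_unif_seq)
      fix z assume "heavy_product z n * 20 ^ n \<le> 13 ^ n * 8 ^ n"
      then have "real (heavy_product z n) * 20 ^ n \<le> 13 ^ n * 8 ^ n"
        by (metis (mono_tags, lifting) of_nat_le_iff of_nat_mult of_nat_numeral of_nat_power)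
      then show "(20/13) ^ n \<le> ?u z"
        using pos[of z] by (simp add: field_simps power_divide)
    qed
    show "{z \<in> space (unif_seq 2). ?u z \<ge> (20/13) ^ n} \<in> events" using meas by measurable
  qed
  also have "\<dots> \<le> (\<integral>z. ?u z \<partial>unif_seq 2) / (20/13) ^ n"
    by (rule integral_Markov_inequality_measure[OF int, of "{}"]) (auto intro!: divide_nonneg_nonneg)
  \<comment> \<open>4147/4200 is the product of 319/210 and 13/20, and its 60th power is below
    1/2.\<close>
  also have "\<dots> = ((4147/4200) ^ 60) ^ i"
    unfolding integral_heavy_product by (simp add: n_def power_mult flip: power_divide)
  also have "\<dots> \<le> (1/2) ^ i"
    by (intro power_mono) (simp_all add: power_divide)
  finally show ?thesis unfolding n_def .
qed

section \<open>Computability of the heavy path and tests against random measures\<close>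

lemma total_rec_lead_bits [rec_intros]:
  assumes "total_rec k e" "total_rec k v"
  shows "total_rec k (\<lambda>xs. lead_bits (code_nth (e xs)) (v xs))"
  unfolding lead_bits_def of_bool_def by (intro rec_intros assms)

lemma total_rec_heavy_node [rec_intros]:
  assumes "total_rec k e" "total_rec k n"
  shows "total_rec k (\<lambda>xs. heavy_node (code_nth (e xs)) (n xs))"
proof (rule total_rec_compose2[OF _ assms])
  show "total_rec 2 (\<lambda>xs. heavy_node (code_nth (xs ! 0)) (xs ! 1))"
    unfolding heavy_node_def heavy_child_def by (intro total_rec_recursion rec_intros) simp_all
qed

lemma total_rec_heavy_product [rec_intros]:
  assumes "total_rec k e" "total_rec k n"
  shows "total_rec k (\<lambda>xs. heavy_product (code_nth (e xs)) (n xs))"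
proof (rule total_rec_compose2[OF _ assms])
  show "total_rec 2 (\<lambda>xs. heavy_product (code_nth (xs ! 0)) (xs ! 1))"
    unfolding heavy_product_def heavy_weight_def by (intro total_rec_recursion rec_intros) simp_all
qed

lemma mlrandom_heavy_product:
  assumes "mlrandom 2 z"
  shows "\<exists>i0. \<forall>i\<ge>i0. 13 ^ (60 * i) * 8 ^ (60 * i) < heavy_product z (60 * i) * 20 ^ (60 * i)"
proof -
  have "\<exists>i0. \<forall>i\<ge>i0. \<forall>m::nat. \<not> heavy_product z (60 * i) * 20 ^ (60 * i) \<le> 13 ^ (60 * i) * 8 ^ (60 * i)"
  proof (rule mlrandom_eventually_avoids[OF assms, where N = "\<lambda>i m. prod_encode (4 * 2 ^ (60 * i), 3)"])
    show "decidable 3 (\<lambda>xs. heavy_product (code_nth (xs ! 2)) (60 * xs ! 0) * 20 ^ (60 * xs ! 0) \<le> 13 ^ (60 * xs ! 0) * 8 ^ (60 * xs ! 0))"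
      by (intro rec_intros) simp_all
    show "total_rec 2 (\<lambda>xs. prod_encode (4 * 2 ^ (60 * xs ! 0), 3))"
      by (intro rec_intros) simp_all
    show "heavy_product y (60 * i) * 20 ^ (60 * i) \<le> 13 ^ (60 * i) * 8 ^ (60 * i)"
      if "\<And>j. j < prod_encode (4 * 2 ^ (60 * i), 3) \<Longrightarrow> x j = y j"
        "heavy_product x (60 * i) * 20 ^ (60 * i) \<le> 13 ^ (60 * i) * 8 ^ (60 * i)" for i and m :: nat and x y
      using heavy_product_cong[OF that(1)] that(2) by simp
    show "measure (unif_seq 2) {z \<in> seq_space 2. \<exists>m::nat. heavy_product z (60 * i) * 20 ^ (60 * i) \<le> 13 ^ (60 * i) * 8 ^ (60 * i)}
        \<le> (1/2) ^ i" for i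
      using measure_heavy_product_le[of i] by simp
  qed
  then show ?thesis by (simp add: not_le)
qed

text \<open>Were column 0 constantly 1, the node 1 would be null and the path would start with mass
  0. The first i bits are all 1 with probability \<open>2 ^ -i\<close>, which fits the bound of a
  test.\<close>

lemma mlrandom_bit_not_one:
  assumes "mlrandom 2 z"
  shows "\<exists>k. z (prod_encode (0, k)) \<noteq> 1"
proof -
  interpret prob_space "unif_seq 2" by (rule prob_space_unif_seq)
  let ?f = "\<lambda>i z. of_bool (\<forall>k<i. z (prod_encode (0, k)) = (1::nat)) :: real"
  \<comment> \<open>The trivial \<open>1 = 1\<close> brings the bit into the form of
    \<open>integral_coord_indicator\<close>.\<close>
  let ?g = "\<lambda>i z. of_bool ((z (prod_encode (0, i)) = (1::nat)) = (1 = (1::nat))) :: real"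
  have dep: "(\<forall>k<i. x (prod_encode (0, k)) = 1) = (\<forall>k<i. y (prod_encode (0, k)) = 1)"
    if "\<And>j. j < prod_encode (1, i) \<Longrightarrow> x j = y j" for i and x y :: "nat \<Rightarrow> nat"
    using that prod_encode_less[of 0 1 _ i] by (metis less_imp_le zero_less_one)
  have meas: "?f i \<in> borel_measurable (unif_seq 2)" "?g i \<in> borel_measurable (unif_seq 2)" for i
  proof -
    show "?f i \<in> borel_measurable (unif_seq 2)"
      by (rule borel_measurable_unif_seq[of "prod_encode (1, i)"]) (rule arg_cong[where f = of_bool], rule dep, simp)
    show "?g i \<in> borel_measurable (unif_seq 2)"
      by (rule borel_measurable_unif_seq[of "Suc (prod_encode (0, i))"]) simp
  qed
  have E: "(\<integral>z. ?f i z \<partial>unif_seq 2) = (1/2) ^ i" for i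
  proof (induction i)
    case 0 show ?case using prob_space by simp
  next
    case (Suc i)
    have "(\<integral>z. ?f (Suc i) z \<partial>unif_seq 2) = (\<integral>z. ?f i z * ?g i z \<partial>unif_seq 2)"
      by (intro Bochner_Integration.integral_cong refl) (auto simp: less_Suc_eq)
    also have "\<dots> = (\<integral>z. ?f i z \<partial>unif_seq 2) * (\<integral>z. ?g i z \<partial>unif_seq 2)"
    proof (rule unif_seq_mult[OF meas, where B = 1 and C = 1])
      show "?f i x = ?f i y" if *: "\<And>j. j \<in> (\<lambda>k. prod_encode (0, k)) ` {..<i} \<Longrightarrow> x j = y j" for x y
      proof -
        have "x (prod_encode (0, k)) = y (prod_encode (0, k))" if "k < i" for k
          using that by (intro *) blast
        then show ?thesis by simp
      qed
      show "?g i x = ?g i y" if "\<And>j. j \<in> {prod_encode (0, i)} \<Longrightarrow> x j = y j" for x y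
        using that[of "prod_encode (0, i)"] by simp
    qed (auto simp: prod_encode_eq)
    finally show ?case using Suc integral_coord_indicator[of 1 "prod_encode (0, i)"] by simp
  qed
  have "\<exists>i0. \<forall>i\<ge>i0. \<forall>m::nat. \<not> (\<forall>k<i. z (prod_encode (0, k)) = 1)"
  proof (rule mlrandom_eventually_avoids[OF assms, where N = "\<lambda>i m. prod_encode (1, i)"])
    show "decidable 3 (\<lambda>xs. \<forall>k<xs ! 0. code_nth (xs ! 2) (prod_encode (0, k)) = 1)"
      by (intro rec_intros) simp_all
    show "total_rec 2 (\<lambda>xs. prod_encode (1, xs ! 0))"
      by (intro rec_intros) simp_all
    show "\<forall>k<i. y (prod_encode (0, k)) = 1"
      if "\<And>j. j < prod_encode (1, i) \<Longrightarrow> x j = y j" "\<forall>k<i. x (prod_encode (0, k)) = 1"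
      for i and m :: nat and x y :: "nat \<Rightarrow> nat"
      using dep[of i x y] that by blast
    fix i
    have "{z. \<forall>k<i. z (prod_encode (0, k)) = (1::nat)} \<in> events"
      by (rule finite_dependence_sets[of "prod_encode (1, i)"]) (use dep in blast)
    moreover have "?f i = indicator {z. \<forall>k<i. z (prod_encode (0, k)) = (1::nat)}"
      by (auto simp: indicator_def)
    ultimately have "prob {z. \<forall>k<i. z (prod_encode (0, k)) = 1} = (1/2) ^ i"
      using E[of i] by simp
    moreover have "prob {z \<in> seq_space 2. \<exists>m::nat. \<forall>k<i. z (prod_encode (0, k)) = 1} \<le>
        prob {z. \<forall>k<i. z (prod_encode (0, k)) = 1}"
      by (rule finite_measure_mono) (use \<open>_ \<in> events\<close> in auto)
    ultimately show "prob {z \<in> seq_space 2. \<exists>m::nat. \<forall>k<i. z (prod_encode (0, k)) = 1} \<le> (1/2) ^ i"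
      by simp
  qed
  then show ?thesis by blast
qed

text \<open>A missing bit at position k costs \<open>(1/2) ^ (k + 1)\<close>, and the bits after it
  cannot make up for the loss.\<close>

lemma column_less_1:
  assumes "z \<in> seq_space 2" "z (prod_encode (v, k)) \<noteq> 1"
  shows "column z v < 1"
proof -
  have bit: "z (prod_encode (v, j)) \<le> 1" for j
    using assms(1) by (auto simp: seq_space_def less_Suc_eq_le numeral_2_eq_2)
  have geo: "(\<Sum>j<n. (1/2 :: real) ^ Suc j) = 1 - (1/2) ^ n" for n
    by (induction n) auto
  have "column z v \<le> (\<Sum>j<Suc k. real (z (prod_encode (v, j))) * (1/2) ^ Suc j) + (1/2) ^ Suc k"
    by (rule column_split(2)[OF assms(1)])
  also have "(\<Sum>j<Suc k. real (z (prod_encode (v, j))) * (1/2) ^ Suc j) =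
      (\<Sum>j<k. real (z (prod_encode (v, j))) * (1/2) ^ Suc j)"
    using bit[of k] assms(2) by (simp add: le_Suc_eq)
  also have "\<dots> \<le> (\<Sum>j<k. 1 * (1/2) ^ Suc j)"
    using bit by (intro sum_mono mult_right_mono) auto
  finally have "column z v \<le> 1 - (1/2) ^ Suc k" using geo[of k] by simp
  also have "\<dots> < 1" by simp
  finally show ?thesis .
qed

text \<open>If the leading bits are worth m, the column lies between m/8 and (m + 1)/8. The left
  child thus has a share of at least m/8 and the right one of at least 1 - (m + 1)/8 = (7 -
  m)/8.\<close>

lemma heavy_weight_le_share:
  assumes "z \<in> seq_space 2"
  shows "real (heavy_weight z (str_index s)) / 8 * measure (mu_of z) (cylB s)
     \<le> measure (mu_of z) (cylB (s @ [heavy_child z (str_index s)]))"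
proof -
  define v where "v = str_index s"
  have "z j = of_bool (z j = 1)" for j
  proof -
    have "z j < 2" using assms by (simp add: seq_space_def)
    then show ?thesis by (auto simp: less_2_cases_iff)
  qed
  then have "real (lead_bits z v) / 8 = (\<Sum>k<3. real (z (prod_encode (v, k))) * (1/2) ^ Suc k)"
    by (simp add: lead_bits_def eval_nat_numeral)
  then have "real (lead_bits z v) / 8 \<le> column z v" "column z v \<le> real (lead_bits z v) / 8 + 1/8"
    using column_split[OF assms, where N = 3 and n = v] by (simp_all add: power3_eq_cube)
  then have "real (heavy_weight z v) / 8 \<le> (if heavy_child z v then 1 - column z v else column z v)"
    by (auto simp: heavy_weight_def heavy_child_def of_nat_diff)
  then have "real (heavy_weight z v) / 8 * measure (mu_of z) (cylB s) \<le>
     (if heavy_child z v then 1 - column z v else column z v) * measure (mu_of z) (cylB s)"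
    by (rule mult_right_mono) simp
  also have "\<dots> = measure (mu_of z) (cylB (s @ [heavy_child z v]))"
    using mu_of(3,4)[OF assms, of s] by (simp add: v_def)
  finally show ?thesis by (simp add: v_def)
qed

text \<open>The factor \<open>1 - column z 0\<close> is the mass of the node 1, where the path
  begins; hence also the length \<open>n + 1\<close> after \<open>n\<close> steps. The entry
  \<open>True\<close> is recorded for \<open>Fx_cylB_imp_output_begins\<close>.\<close>

lemma exists_heavy_cylinder:
  assumes "z \<in> seq_space 2"
  shows "\<exists>s. length s = Suc n \<and> True \<in> set s \<and> str_index s = heavy_node z n \<and>
     (1 - column z 0) * (real (heavy_product z n) / 8 ^ n) \<le> measure (mu_of z) (cylB s)"
proof (induction n)
  case 0
  interpret prob_space "mu_of z" by (rule mu_of(1)[OF assms])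
  have "measure (mu_of z) (cylB []) = 1"
    using prob_space sets_eq_imp_space_eq[OF mu_of(2)[OF assms]] by (simp add: space_cantor)
  then show ?case
    using mu_of(4)[OF assms, of "[]"] str_index_snoc[of "[]" True]
    by (intro exI[of _ "[True]"]) (simp add: str_index_Nil)
next
  case (Suc n)
  then obtain s where s: "length s = Suc n" "True \<in> set s" "str_index s = heavy_node z n"
     "(1 - column z 0) * (real (heavy_product z n) / 8 ^ n) \<le> measure (mu_of z) (cylB s)"
    by blast
  let ?t = "s @ [heavy_child z (str_index s)]"
  have "(1 - column z 0) * (real (heavy_product z (Suc n)) / 8 ^ Suc n) =
      real (heavy_weight z (str_index s)) / 8 * ((1 - column z 0) * (real (heavy_product z n) / 8 ^ n))"
    by (simp add: s)
  also have "\<dots> \<le> real (heavy_weight z (str_index s)) / 8 * measure (mu_of z) (cylB s)"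
    by (rule mult_left_mono[OF s(4)]) simp
  also have "\<dots> \<le> measure (mu_of z) (cylB ?t)" by (rule heavy_weight_le_share[OF assms])
  finally show ?case
    using s str_index_snoc[of s "heavy_child z (str_index s)"] by (intro exI[of _ ?t]) simp
qed

lemma mlrandom_heavy_cylinders:
  assumes "mlrandom 2 z"
  shows "\<exists>\<delta>>0. \<exists>i0. \<forall>i\<ge>i0. \<exists>s. length s = Suc (60 * i) \<and> True \<in> set s \<and>
     \<delta> * (13/20) ^ (60 * i) \<le> measure (mu_of z) (cylB s)"
proof -
  have z: "z \<in> seq_space 2" using assms by (simp add: mlrandom_def)
  obtain k where "z (prod_encode (0, k)) \<noteq> 1" using mlrandom_bit_not_one[OF assms] by blast
  then have pos: "0 < 1 - column z 0" using column_less_1[OF z] by simp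
  obtain i0 where i0: "\<And>i. i \<ge> i0 \<Longrightarrow> 13 ^ (60 * i) * 8 ^ (60 * i) < heavy_product z (60 * i) * 20 ^ (60 * i)"
    using mlrandom_heavy_product[OF assms] by blast
  have "\<exists>s. length s = Suc (60 * i) \<and> True \<in> set s \<and>
     (1 - column z 0) * (13/20) ^ (60 * i) \<le> measure (mu_of z) (cylB s)" if "i \<ge> i0" for i
  proof -
    define n where "n = 60 * i"
    obtain s where s: "length s = Suc n" "True \<in> set s"
      "(1 - column z 0) * (real (heavy_product z n) / 8 ^ n) \<le> measure (mu_of z) (cylB s)"
      using exists_heavy_cylinder[OF z, of n] by blast
    have "13 ^ n * 8 ^ n \<le> real (heavy_product z n) * 20 ^ n"
      using i0[OF that] unfolding n_def[symmetric]
      by (metis (mono_tags, lifting) of_nat_le_iff of_nat_mult of_nat_numeral of_nat_power less_imp_le)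
    then have "(13/20) ^ n \<le> real (heavy_product z n) / 8 ^ n"
      by (simp add: field_simps power_divide)
    then have "(1 - column z 0) * (13/20) ^ n \<le> measure (mu_of z) (cylB s)"
      using s(3) pos by (meson mult_left_mono less_imp_le order_trans)
    then show ?thesis using s unfolding n_def by blast
  qed
  then show ?thesis using pos by blast
qed

section \<open>Moments of the masses of preimages\<close>

text \<open>The two halves read disjoint coordinates, so they are independent with equal moments;
  the rest is binomial expansion. Arbitrary index types let one statement serve both labels indexed
  by strings and labels listed in a sequence.\<close>

lemma integral_average_powers:
  fixes f :: "('a \<Rightarrow> 'b) \<Rightarrow> real" and h0 h1 :: "'a \<Rightarrow> 'i"
  assumes N: "prob_space N" and f: "f \<in> borel_measurable (PiM UNIV (\<lambda>_. N))"
    and f01: "\<And>X. 0 \<le> f X" "\<And>X. f X \<le> 1"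
    and h: "inj h0" "inj h1" "range h0 \<inter> range h1 = {}"
  defines "E \<equiv> \<lambda>p::nat. \<integral>X. f X ^ p \<partial>PiM UNIV (\<lambda>_. N)"
    and "A \<equiv> \<lambda>x. (f (\<lambda>s. x (h0 s)) + f (\<lambda>s. x (h1 s))) / 2"
  shows "(\<integral>x. A x \<partial>PiM UNIV (\<lambda>_. N)) = E 1"
    "(\<integral>x. A x ^ 2 \<partial>PiM UNIV (\<lambda>_. N)) = (E 2 + E 1 ^ 2) / 2"
    "(\<integral>x. A x ^ 3 \<partial>PiM UNIV (\<lambda>_. N)) = (E 3 + 3 * E 2 * E 1) / 4"
proof -
  let ?P = "PiM UNIV (\<lambda>_::'i. N)"
  interpret P: prob_space ?P by (intro prob_space_PiM N)
  define U V where "U p x = f (\<lambda>s. x (h0 s)) ^ p" and "V p x = f (\<lambda>s. x (h1 s)) ^ p" for p :: nat and x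
  have sub: "(\<lambda>x s. x (h s)) \<in> ?P \<rightarrow>\<^sub>M PiM UNIV (\<lambda>_. N)" for h :: "'a \<Rightarrow> 'i"
    by (rule measurable_PiM_single') (auto simp: space_PiM)
  have U: "U p \<in> borel_measurable ?P" and V: "V p \<in> borel_measurable ?P" for p
    unfolding U_def V_def
    by (intro borel_measurable_power measurable_compose[OF sub[of h0] f],
        intro borel_measurable_power measurable_compose[OF sub[of h1] f])
  have U1: "\<bar>U p x\<bar> \<le> 1" and V1: "\<bar>V p x\<bar> \<le> 1" for p x
    using f01 by (auto simp: U_def V_def power_abs power_le_one)
  have EU: "(\<integral>x. U p x \<partial>?P) = E p" and EV: "(\<integral>x. V p x \<partial>?P) = E p" for p
    unfolding U_def V_def E_def
    using integral_PiM_reindex[OF N borel_measurable_power[OF f], of _ p] h by auto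
  have UV: "(\<integral>x. U p x * V q x \<partial>?P) = E p * E q" for p q
    unfolding EU[of p, symmetric] EV[of q, symmetric]
  proof (rule integral_PiM_mult[where f = "U p" and g = "V q" and J = "range h0" and K = "range h1" and B = 1 and C = 1])
    show "U p x = U p y" if "\<And>j. j \<in> range h0 \<Longrightarrow> x j = y j" for x y using that by (simp add: U_def)
    show "V q x = V q y" if "\<And>j. j \<in> range h1 \<Longrightarrow> x j = y j" for x y using that by (simp add: V_def)
  qed (use N U V U1 V1 h(3) in auto)
  have iU: "integrable ?P (U p)" and iV: "integrable ?P (V p)" for p
    by (rule P.integrable_const_bound[OF AE_I2 U, where B = 1], use U1 in simp)
       (rule P.integrable_const_bound[OF AE_I2 V, where B = 1], use V1 in simp)
  have iUV: "integrable ?P (\<lambda>x. U p x * V q x)" for p q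
  proof (rule P.integrable_const_bound[where B = "1 * 1"])
    show "AE x in ?P. norm (U p x * V q x) \<le> 1 * 1"
      unfolding real_norm_def abs_mult by (intro AE_I2 mult_mono U1 V1) auto
  qed (intro borel_measurable_times U V)
  have "A x = U 1 x / 2 + V 1 x / 2" for x by (simp add: A_def U_def V_def)
  then show "(\<integral>x. A x \<partial>?P) = E 1"
    by (simp add: iU iV EU EV)
  have "A x ^ 2 = U 2 x / 4 + (U 1 x * V 1 x) / 2 + V 2 x / 4" for x
    by (simp add: A_def U_def V_def power2_eq_square field_simps)
  then show "(\<integral>x. A x ^ 2 \<partial>?P) = (E 2 + E 1 ^ 2) / 2"
    by (simp add: iU iV iUV EU EV UV power2_eq_square)
  have "A x ^ 3 = U 3 x / 8 + 3 * (U 2 x * V 1 x) / 8 + 3 * (U 1 x * V 2 x) / 8 + V 3 x / 8" for x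
    by (simp add: A_def U_def V_def power3_eq_cube power2_eq_square field_simps)
  then show "(\<integral>x. A x ^ 3 \<partial>?P) = (E 3 + 3 * E 2 * E 1) / 4"
    by (simp add: iU iV iUV EU EV UV)
qed

text \<open>The share of the paths of length \<open>L\<close> from the root along which the labels, with the 2's
  deleted, begin with the given string; the root itself carries no label.\<close>
fun match_mass :: "nat \<Rightarrow> bool list \<Rightarrow> (bool list \<Rightarrow> nat) \<Rightarrow> real" where
  "match_mass L [] X = 1"
| "match_mass 0 (b # s) X = 0"
| "match_mass (Suc L) (b # s) X =
    ((if X [False] = 2 then match_mass L (b # s) (\<lambda>t. X (False # t))
      else if (X [False] = 1) = b then match_mass L s (\<lambda>t. X (False # t)) else 0) +
     (if X [True] = 2 then match_mass L (b # s) (\<lambda>t. X (True # t))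
      else if (X [True] = 1) = b then match_mass L s (\<lambda>t. X (True # t)) else 0)) / 2"

lemma match_mass_bounds: "0 \<le> match_mass L s X \<and> match_mass L s X \<le> 1"
proof (induction L s X rule: match_mass.induct)
  case (3 L b s X)
  define u v where "u = (if X [False] = 2 then match_mass L (b # s) (\<lambda>t. X (False # t))
      else if (X [False] = 1) = b then match_mass L s (\<lambda>t. X (False # t)) else 0)"
    and "v = (if X [True] = 2 then match_mass L (b # s) (\<lambda>t. X (True # t))
      else if (X [True] = 1) = b then match_mass L s (\<lambda>t. X (True # t)) else 0)"
  have "0 \<le> u \<and> u \<le> 1" "0 \<le> v \<and> v \<le> 1" using 3 by (auto simp: u_def v_def)
  moreover have "match_mass (Suc L) (b # s) X = (u + v) / 2" by (simp add: u_def v_def)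
  ultimately show ?case by simp
qed auto

lemma match_mass_mono: "match_mass L s X \<le> match_mass (Suc L) s X"
proof (induction L s X rule: match_mass.induct)
  case (2 b s X) show ?case using match_mass_bounds[of "Suc 0" "b # s" X] by simp
next
  case (3 L b s X)
  then show ?case
    unfolding match_mass.simps(3)[of "Suc L"] match_mass.simps(3)[of L]
    by (intro divide_right_mono add_mono) (auto simp del: match_mass.simps)
qed simp

text \<open>The label at the root is never read; in a subtree it is therefore independent of the
  mass below it.\<close>

lemma match_mass_cong:
  "(\<And>t. t \<noteq> [] \<Longrightarrow> X t = Y t) \<Longrightarrow> match_mass L s X = match_mass L s Y"
proof (induction L s X arbitrary: Y rule: match_mass.induct)
  case (3 L b s X)
  have "(\<lambda>t. X (c # t)) = (\<lambda>t. Y (c # t))" for c using 3(5) by simp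
  then show ?case using 3(5) by simp
qed auto

lemma measurable_match_mass [measurable]:
  "match_mass L s \<in> borel_measurable (PiM UNIV (\<lambda>_. measure_pmf p))"
proof (induction L arbitrary: s)
  case 0 show ?case by (cases s) auto
next
  case (Suc L)
  have sub: "(\<lambda>X t. X (c # t)) \<in> PiM UNIV (\<lambda>_. measure_pmf p) \<rightarrow>\<^sub>M PiM UNIV (\<lambda>_. measure_pmf p)" for c :: bool
    by (rule measurable_PiM_single') (auto simp: space_PiM)
  have [measurable]: "(\<lambda>X. match_mass L s (\<lambda>t. X (c # t))) \<in> borel_measurable (PiM UNIV (\<lambda>_. measure_pmf p))" for c s
    by (rule measurable_compose[OF sub Suc])
  have [measurable]: "(\<lambda>X. X s) \<in> PiM UNIV (\<lambda>_. measure_pmf p) \<rightarrow>\<^sub>M count_space UNIV" for s :: "bool list"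
  proof -
    have "(\<lambda>X. X s) \<in> PiM UNIV (\<lambda>_. measure_pmf p) \<rightarrow>\<^sub>M measure_pmf p"
      by (rule measurable_component_singleton) simp
    then show ?thesis by simp
  qed
  show ?case
  proof (cases s)
    case (Cons b s)
    show ?thesis unfolding Cons match_mass.simps(3)[abs_def] by measurable
  qed simp
qed

text \<open>The contribution of a subtree whose root does carry a label: 2 prints nothing, a correct
  symbol is consumed, a wrong one kills the branch.\<close>

definition branch_mass :: "nat \<Rightarrow> bool \<Rightarrow> bool list \<Rightarrow> (bool list \<Rightarrow> nat) \<Rightarrow> real" where
  "branch_mass L b s X = (if X [] = 2 then match_mass L (b # s) X
     else if (X [] = 1) = b then match_mass L s X else 0)"

lemma match_mass_Suc:
  "match_mass (Suc L) (b # s) X = (branch_mass L b s (\<lambda>t. X (False # t)) + branch_mass L b s (\<lambda>t. X (True # t))) / 2"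
  by (simp add: branch_mass_def)

abbreviation label_tree :: "(bool list \<Rightarrow> nat) measure" where
  "label_tree \<equiv> PiM UNIV (\<lambda>_. measure_pmf (pmf_of_set {..<3}))"

lemma measurable_label_tree_coord [measurable]: "(\<lambda>X. X s) \<in> label_tree \<rightarrow>\<^sub>M count_space UNIV"
proof -
  have "(\<lambda>X. X s) \<in> label_tree \<rightarrow>\<^sub>M measure_pmf (pmf_of_set {..<3})"
    by (rule measurable_component_singleton) simp
  then show ?thesis by simp
qed

text \<open>Of the three equally likely labels one keeps the string, one removes its first symbol,
  and one gives mass 0, whose power vanishes since \<open>0 < p\<close>.\<close>

lemma integral_branch_mass_power:
  assumes "0 < p"
  shows "(\<integral>X. branch_mass L b s X ^ p \<partial>label_tree)
     = ((\<integral>X. match_mass L (b # s) X ^ p \<partial>label_tree) + (\<integral>X. match_mass L s X ^ p \<partial>label_tree)) / 3"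
proof -
  interpret prob_space label_tree by (intro prob_space_PiM measure_pmf.prob_space_axioms)
  let ?I = "\<lambda>l X. of_bool (X [] = l) :: real" 
  have I_meas: "?I l \<in> borel_measurable label_tree" for l :: nat by measurable
  have M_meas: "(\<lambda>X. match_mass L s X ^ p) \<in> borel_measurable label_tree" for s by measurable
  have M1: "\<bar>match_mass L s X ^ p\<bar> \<le> 1" for s X
    using match_mass_bounds[of L s X] by (simp add: power_abs power_le_one)
  have EI: "(\<integral>X. ?I l X \<partial>label_tree) = 1/3" if "l < 3" for l
  proof -
    let ?N = "measure_pmf (pmf_of_set {..<3::nat})"
    have "(\<integral>X. ?I l X \<partial>label_tree) = (\<integral>j. of_bool (j = l) \<partial>distr label_tree ?N (\<lambda>X. X []))"
      by (subst integral_distr) auto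
    also have "distr label_tree ?N (\<lambda>X. X []) = ?N"
      by (rule distr_PiM_component) (auto intro: measure_pmf.prob_space_axioms)
    also have "(\<integral>j. of_bool (j = l) \<partial>?N) = (1/3 :: real)"
      using that by (subst integral_pmf_of_set) (auto simp: of_bool_def)
    finally show ?thesis .
  qed
  have prod: "(\<integral>X. ?I l X * match_mass L s X ^ p \<partial>label_tree) = (\<integral>X. match_mass L s X ^ p \<partial>label_tree) / 3"
    if "l < 3" for l s
  proof -
    have "(\<integral>X. ?I l X * match_mass L s X ^ p \<partial>label_tree) =
        (\<integral>X. ?I l X \<partial>label_tree) * (\<integral>X. match_mass L s X ^ p \<partial>label_tree)"
    proof (rule integral_PiM_mult[OF measure_pmf.prob_space_axioms I_meas M_meas _ M1])
      show "\<bar>?I l X\<bar> \<le> 1" for X by simp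
      show "?I l X = ?I l Y" if "\<And>t. t \<in> {[]} \<Longrightarrow> X t = Y t" for X Y using that by simp
      show "match_mass L s X ^ p = match_mass L s Y ^ p" if "\<And>t. t \<in> - {[]} \<Longrightarrow> X t = Y t" for X Y
        using match_mass_cong[of X Y L s] that by simp
    qed simp
    then show ?thesis using EI[OF that] by simp
  qed
  have int: "integrable label_tree (\<lambda>X. ?I l X * match_mass L s X ^ p)" for l s
    by (rule integrable_const_bound[OF AE_I2, where B = 1])
       (use M1 I_meas M_meas in \<open>auto simp: of_bool_def\<close>)
  \<comment> \<open>A label above 2 would pass for the symbol 0, so the decomposition below holds
    only almost everywhere.\<close>
  have supp: "AE X in label_tree. X [] < 3"
  proof (rule AE_PiM_component)
    have "set_pmf (pmf_of_set {..<3::nat}) = {..<3}" by (rule set_pmf_of_set) (auto simp: lessThan_empty_iff)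
    then show "AE l in measure_pmf (pmf_of_set {..<3::nat}). l < 3" by (auto simp: AE_measure_pmf_iff)
  qed (auto intro: measure_pmf.prob_space_axioms)
  have "(\<integral>X. branch_mass L b s X ^ p \<partial>label_tree) =
     (\<integral>X. ?I 2 X * match_mass L (b # s) X ^ p + ?I (of_bool b) X * match_mass L s X ^ p \<partial>label_tree)"
  proof (rule integral_cong_AE)
    show "AE X in label_tree. branch_mass L b s X ^ p =
        ?I 2 X * match_mass L (b # s) X ^ p + ?I (of_bool b) X * match_mass L s X ^ p"
      using supp
    proof eventually_elim
      case (elim X)
      then have "X [] = 0 \<or> X [] = 1 \<or> X [] = 2" by linarith
      then show ?case using assms by (auto simp: branch_mass_def of_bool_def)
    qed
    show "(\<lambda>X. branch_mass L b s X ^ p) \<in> borel_measurable label_tree"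
      unfolding branch_mass_def by measurable
  qed (intro borel_measurable_add borel_measurable_times I_meas M_meas)
  also have "\<dots> = ((\<integral>X. match_mass L (b # s) X ^ p \<partial>label_tree) + (\<integral>X. match_mass L s X ^ p \<partial>label_tree)) / 3"
    by (subst Bochner_Integration.integral_add[OF int int]) (simp add: prod del: match_mass.simps)
  finally show ?thesis .
qed

lemma branch_mass_bounds: "0 \<le> branch_mass L b s X" "branch_mass L b s X \<le> 1"
  using match_mass_bounds[of L "b # s" X] match_mass_bounds[of L s X] by (auto simp: branch_mass_def)

lemma measurable_branch_mass: "branch_mass L b s \<in> borel_measurable label_tree"
  unfolding branch_mass_def[abs_def] by measurable

text \<open>The constants are the least ones reproduced by the recursion.\<close>
lemma match_mass_moments:
  "(\<integral>X. match_mass L s X \<partial>label_tree) \<le> (1/2) ^ length s \<and>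
    (\<integral>X. match_mass L s X ^ 2 \<partial>label_tree) \<le> 3 * (1/4) ^ length s \<and>
    (\<integral>X. match_mass L s X ^ 3 \<partial>label_tree) \<le> 15 * (1/8) ^ length s"
proof (induction L arbitrary: s)
  case 0
  interpret prob_space label_tree by (intro prob_space_PiM measure_pmf.prob_space_axioms)
  show ?case using prob_space by (cases s) auto
next
  case (Suc L)
  interpret prob_space label_tree by (intro prob_space_PiM measure_pmf.prob_space_axioms)
  show ?case
  proof (cases s)
    case Nil then show ?thesis using prob_space by simp
  next
    case (Cons b t)
    define e where "e p = (\<integral>X. branch_mass L b t X ^ p \<partial>label_tree)" for p
    define n where "n = length t"
    \<comment> \<open>Since the two strings differ in length by one, the constant of the p-th moment
      is multiplied by \<open>(1 + 2 ^ p) / 3\<close>: 1, 3, 15 become 1, 5, 45 for branches.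
      Averaging two branches gives back (5 + 1)/2 = 3 and (45 + 3 * 5)/4 = 15.\<close>
    have e1: "e 1 \<le> (1/2) ^ Suc n" "0 \<le> e 1"
      using Suc[of "b # t"] Suc[of t] integral_branch_mass_power[of 1 L b t] branch_mass_bounds(1)
      by (auto simp: e_def n_def intro!: Bochner_Integration.integral_nonneg)
    have e2: "e 2 \<le> 5 * (1/4) ^ Suc n" "0 \<le> e 2"
      using Suc[of "b # t"] Suc[of t] integral_branch_mass_power[of 2 L b t]
      by (auto simp: e_def n_def)
    have e3: "e 3 \<le> 45 * (1/8) ^ Suc n"
      using Suc[of "b # t"] Suc[of t] integral_branch_mass_power[of 3 L b t]
      by (auto simp: e_def n_def)
    have mass: "match_mass (Suc L) s = (\<lambda>X. (branch_mass L b t (\<lambda>t. X (False # t)) + branch_mass L b t (\<lambda>t. X (True # t))) / 2)"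
      unfolding Cons by (rule ext) (rule match_mass_Suc)
    note avg = integral_average_powers[OF measure_pmf.prob_space_axioms measurable_branch_mass
        branch_mass_bounds, of "Cons False" "Cons True" L b t]
    have "e 1 ^ 2 \<le> ((1/2) ^ Suc n) ^ 2" by (rule power_mono[OF e1])
    also have "\<dots> = (1/4) ^ Suc n" by (simp only: power_mult[symmetric] mult.commute[of _ 2])
      (simp only: power_mult power2_eq_square, simp)
    finally have e11: "e 1 ^ 2 \<le> (1/4) ^ Suc n" .
    have "e 2 * e 1 \<le> 5 * (1/4) ^ Suc n * (1/2) ^ Suc n" by (rule mult_mono[OF e2(1) e1(1)]) (use e1 in auto)
    also have "\<dots> = 5 * (1/8) ^ Suc n" by (simp add: power_mult_distrib flip: power_mult_distrib)
    finally have e21: "e 2 * e 1 \<le> 5 * (1/8) ^ Suc n" .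
    have "length s = Suc n" by (simp add: Cons n_def)
    moreover have "(\<integral>X. match_mass (Suc L) s X \<partial>label_tree) = e 1"
      "(\<integral>X. match_mass (Suc L) s X ^ 2 \<partial>label_tree) = (e 2 + e 1 ^ 2) / 2"
      "(\<integral>X. match_mass (Suc L) s X ^ 3 \<partial>label_tree) = (e 3 + 3 * e 2 * e 1) / 4"
      unfolding mass e_def by (rule avg; auto)+
    ultimately show ?thesis using e1 e2 e3 e11 e21 by auto
  qed
qed

text \<open>By truncated subtraction the empty string shares the entry of \<open>[False]\<close>, so
  injectivity of the reindexing fails at the root.\<close>

definition labels_of :: "(nat \<Rightarrow> nat) \<Rightarrow> bool list \<Rightarrow> nat" where
  "labels_of x s = x (str_index s - 1)"

lemma inj_str_index: "inj str_index"
  by (metis injI sigma_str_index)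

lemma str_index_eq_0_iff: "str_index s = 0 \<longleftrightarrow> s = []"
  by (metis sigma_str_index str_index_Nil)

text \<open>Only nonempty strings carry distinct entries of \<open>x\<close>. The integrals over
  sequences and over label trees are therefore both reduced to the two subtrees of the root, where
  the reindexing is injective, and \<open>integral_average_powers\<close> gives them the same
  value.\<close>

lemma integral_match_mass_labels:
  assumes "s \<noteq> []"
  shows "(\<integral>x. match_mass L s (labels_of x) ^ 3 \<partial>unif_seq 3) \<le> 15 * (1/8) ^ length s"
proof (cases L)
  case 0 then show ?thesis using assms by (cases s) auto
next
  case (Suc L')
  obtain b t where s: "s = b # t" using assms by (cases s) auto
  have inj: "inj (\<lambda>t. str_index (c # t) - 1)" for c
  proof (rule injI)
    fix u v assume "str_index (c # u) - 1 = str_index (c # v) - 1"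
    moreover have "str_index (c # u) \<noteq> 0" "str_index (c # v) \<noteq> 0" by (simp_all add: str_index_eq_0_iff)
    ultimately have "str_index (c # u) = str_index (c # v)" by linarith
    then show "u = v" using inj_str_index by (auto dest: injD)
  qed
  have disj: "range (\<lambda>t. str_index (False # t) - 1) \<inter> range (\<lambda>t. str_index (True # t) - 1) = {}"
  proof -
    have "str_index (False # u) - 1 \<noteq> str_index (True # v) - 1" for u v
    proof
      assume "str_index (False # u) - 1 = str_index (True # v) - 1"
      moreover have "str_index (False # u) \<noteq> 0" "str_index (True # v) \<noteq> 0" by (simp_all add: str_index_eq_0_iff)
      ultimately have "str_index (False # u) = str_index (True # v)" by linarith
      then show False using inj_str_index by (auto dest: injD)
    qed
    then show ?thesis by auto
  qed
  have mass: "match_mass L s (labels_of x) = (branch_mass L' b t (\<lambda>t. x (str_index (False # t) - 1)) +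
      branch_mass L' b t (\<lambda>t. x (str_index (True # t) - 1))) / 2" for x
    unfolding Suc s match_mass_Suc by (simp add: labels_of_def)
  have "(\<integral>x. match_mass L s (labels_of x) ^ 3 \<partial>unif_seq 3) = (\<integral>X. match_mass L s X ^ 3 \<partial>label_tree)"
    unfolding mass unif_seq_def
    unfolding Suc s match_mass_Suc
    by (subst integral_average_powers(3)[OF measure_pmf.prob_space_axioms measurable_branch_mass branch_mass_bounds inj inj disj],
        subst integral_average_powers(3)[OF measure_pmf.prob_space_axioms measurable_branch_mass branch_mass_bounds])
       auto
  then show ?thesis using match_mass_moments[of L s] by simp
qed

section \<open>Cylinder masses of random continuous functions\<close>

text \<open>A sum and not a cardinality, to fit \<open>total_rec_sum\<close>.\<close>

definition output_length :: "(nat \<Rightarrow> nat) \<Rightarrow> nat \<Rightarrow> nat" where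
  "output_length l k = (\<Sum>j<k. if l j = 2 then 0 else 1)"

text \<open>The first \<open>L\<close> labels, with the 2's deleted, begin with \<open>\<tau> 0, \<dots>, \<tau> (n - 1)\<close>.\<close>
definition output_begins :: "(nat \<Rightarrow> bool) \<Rightarrow> nat \<Rightarrow> (nat \<Rightarrow> nat) \<Rightarrow> nat \<Rightarrow> bool" where
  "output_begins \<tau> n l L \<longleftrightarrow> n \<le> output_length l L \<and>
     (\<forall>k<L. l k \<noteq> 2 \<and> output_length l k < n \<longrightarrow> (l k = 1 \<longleftrightarrow> \<tau> (output_length l k)))"

lemma output_length_0 [simp]: "output_length l 0 = 0"
  by (simp add: output_length_def)

lemma output_length_shift:
  "output_length l (Suc k) = (if l 0 = 2 then 0 else 1) + output_length (\<lambda>j. l (Suc j)) k"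
  unfolding output_length_def by (subst sum.lessThan_Suc_shift) simp

lemma output_length_mono: "j \<le> k \<Longrightarrow> output_length l j \<le> output_length l k"
  unfolding output_length_def by (rule sum_mono2) auto

lemma output_begins_mono: "output_begins \<tau> n l L \<Longrightarrow> L \<le> L' \<Longrightarrow> output_begins \<tau> n l L'"
  unfolding output_begins_def
  by (metis leD leI order_trans output_length_mono)

lemma output_begins_cong:
  assumes "\<And>k. k < L \<Longrightarrow> l k = l' k" "\<And>j. j < n \<Longrightarrow> \<tau> j = \<tau>' j"
  shows "output_begins \<tau> n l L = output_begins \<tau>' n l' L"
proof -
  have "output_length l k = output_length l' k" if "k \<le> L" for k
    unfolding output_length_def using that assms(1) by (intro sum.cong) auto
  then show ?thesis using assms by (auto simp: output_begins_def)
qed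

lemma output_begins_0 [simp]: "output_begins \<tau> 0 l L"
  by (simp add: output_begins_def)

lemma output_begins_Suc:
  "output_begins \<tau> (Suc n) l (Suc L) \<longleftrightarrow>
    (if l 0 = 2 then output_begins \<tau> (Suc n) (\<lambda>j. l (Suc j)) L
     else (l 0 = 1 \<longleftrightarrow> \<tau> 0) \<and> output_begins (\<lambda>j. \<tau> (Suc j)) n (\<lambda>j. l (Suc j)) L)"
  unfolding output_begins_def All_less_Suc2 output_length_shift by auto

text \<open>The recursive form serves expectations; counting the strings of length \<open>L\<close>
  serves computability and the comparison with Lebesgue measure.\<close>

lemma match_mass_eq_card:
  "match_mass L s X = card {t. length t = L \<and> output_begins ((!) s) (length s) (\<lambda>k. X (take (Suc k) t)) L} / 2 ^ L"
proof (induction L arbitrary: s X)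
  case 0
  show ?case
  proof (cases s)
    case (Cons b t) then show ?thesis by (simp add: output_begins_def)
  qed simp
next
  case (Suc L)
  show ?case
  proof (cases s)
    case Nil
    have "card {t :: bool list. length t = Suc L} = 2 ^ Suc L"
      using card_lists_length_eq[of "UNIV :: bool set" "Suc L"] by simp
    then show ?thesis by (simp add: Nil)
  next
    case (Cons b s')
    define R where "R c = {t. length t = L \<and> output_begins ((!) s) (length s) (\<lambda>k. X (take (Suc k) (c # t))) (Suc L)}" for c
    have fin: "finite (R c)" for c
      by (rule finite_subset[OF _ finite_lists_length_eq[of "UNIV :: bool set" L]]) (auto simp: R_def)
    have "{t. length t = Suc L \<and> output_begins ((!) s) (length s) (\<lambda>k. X (take (Suc k) t)) (Suc L)} =
        Cons False ` R False \<union> Cons True ` R True"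
    proof (intro equalityI subsetI)
      fix t assume "t \<in> {t. length t = Suc L \<and> output_begins ((!) s) (length s) (\<lambda>k. X (take (Suc k) t)) (Suc L)}"
      then obtain c u where "t = c # u" "u \<in> R c" by (cases t) (auto simp: R_def)
      then show "t \<in> Cons False ` R False \<union> Cons True ` R True" by (cases c) auto
    qed (auto simp: R_def)
    note split = this
    have card: "card {t. length t = Suc L \<and> output_begins ((!) s) (length s) (\<lambda>k. X (take (Suc k) t)) (Suc L)} =
        card (R False) + card (R True)"
      unfolding split by (subst card_Un_disjoint) (auto simp: fin card_image)
    have "card (R c) / 2 ^ L = branch_mass L b s' (\<lambda>t. X (c # t))" for c
    proof -
      have "R c = (if X [c] = 2 then {t. length t = L \<and> output_begins ((!) s) (length s) (\<lambda>k. X (c # take (Suc k) t)) L}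
          else if (X [c] = 1) = b then {t. length t = L \<and> output_begins ((!) s') (length s') (\<lambda>k. X (c # take (Suc k) t)) L}
          else {})"
        unfolding R_def Cons list.size add_Suc_right add_0_right output_begins_Suc by auto
      then show ?thesis
        using Suc[of s "\<lambda>t. X (c # t)"] Suc[of s' "\<lambda>t. X (c # t)"] by (simp add: branch_mass_def Cons)
    qed
    moreover have "match_mass (Suc L) s X =
        (branch_mass L b s' (\<lambda>t. X (False # t)) + branch_mass L b s' (\<lambda>t. X (True # t))) / 2"
      unfolding Cons by (rule match_mass_Suc)
    ultimately have "match_mass (Suc L) s X = (card (R False) / 2 ^ L + card (R True) / 2 ^ L) / 2"
      by simp
    also have "\<dots> = real (card (R False) + card (R True)) / 2 ^ Suc L"
      by (simp add: add_divide_distrib)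
    finally show ?thesis unfolding card .
  qed
qed

lemma str_index_range: "2 ^ length s \<le> Suc (str_index s) \<and> Suc (str_index s) < 2 ^ Suc (length s)"
  by (induction s rule: rev_induct) (auto simp: str_index_Nil str_index_snoc)

text \<open>\<open>Suc (str_index s)\<close> has the binary digits 1 followed by s, so passing to a
  prefix drops digits at the end.\<close>

lemma str_index_take:
  "k \<le> length s \<Longrightarrow> Suc (str_index (take k s)) = Suc (str_index s) div 2 ^ (length s - k)"
proof (induction s rule: rev_induct)
  case (snoc b s)
  show ?case
  proof (cases "k \<le> length s")
    case True
    have "Suc (str_index (s @ [b])) div 2 = Suc (str_index s)" by (simp add: str_index_snoc)
    then have "Suc (str_index (s @ [b])) div 2 ^ Suc (length s - k) = Suc (str_index s) div 2 ^ (length s - k)"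
      by (simp only: power_Suc div_mult2_eq)
    then show ?thesis using True snoc by (simp add: Suc_diff_le)
  next
    case False
    then have "k = length (s @ [b])" using snoc.prems by simp
    then show ?thesis by simp
  qed
qed simp

lemma bij_betw_strings: "bij_betw (\<lambda>s. Suc (str_index s) - 2 ^ L) {s. length s = L} {..<2 ^ L}"
proof -
  have inj: "inj_on (\<lambda>s. Suc (str_index s) - 2 ^ L) {s. length s = L}"
  proof (rule inj_onI)
    fix s t assume "s \<in> {s. length s = L}" "t \<in> {s. length s = L}"
      "Suc (str_index s) - 2 ^ L = Suc (str_index t) - 2 ^ L"
    then have "str_index s = str_index t" using str_index_range[of s] str_index_range[of t]
      by (auto dest: eq_diff_iff[THEN iffD1, rotated 2])
    then show "s = t" using inj_str_index by (auto dest: injD)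
  qed
  moreover have "(\<lambda>s. Suc (str_index s) - 2 ^ L) ` {s. length s = L} = {..<2 ^ L}"
  proof (rule card_subset_eq)
    show "(\<lambda>s. Suc (str_index s) - 2 ^ L) ` {s. length s = L} \<subseteq> {..<2 ^ L}"
    proof (rule image_subsetI)
      fix s assume "s \<in> {s :: bool list. length s = L}"
      then have "Suc (str_index s) < 2 ^ L + 2 ^ L" using str_index_range[of s] by simp
      then show "Suc (str_index s) - 2 ^ L \<in> {..<2 ^ L}"
        unfolding lessThan_iff by linarith
    qed
    have "card {s :: bool list. length s = L} = 2 ^ L"
      using card_lists_length_eq[of "UNIV :: bool set" L] by simp
    then show "card ((\<lambda>s. Suc (str_index s) - 2 ^ L) ` {s. length s = L}) = card {..<2 ^ L :: nat}"
      by (simp add: card_image[OF inj])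
  qed simp
  ultimately show ?thesis by (simp add: bij_betw_def)
qed

text \<open>The node of depth \<open>k + 1\<close> above the \<open>u\<close>-th node of depth \<open>L\<close> has index
  \<open>(2 ^ L + u) div 2 ^ (L - 1 - k) - 1\<close>, and labels are shifted by one more.\<close>
definition match_count :: "(nat \<Rightarrow> bool) \<Rightarrow> nat \<Rightarrow> (nat \<Rightarrow> nat) \<Rightarrow> nat \<Rightarrow> nat" where
  "match_count \<tau> n x L =
     (\<Sum>u<2 ^ L. if output_begins \<tau> n (\<lambda>k. x ((2 ^ L + u) div 2 ^ (L - Suc k) - 2)) L then 1 else 0)"

lemma match_mass_eq_count: "match_mass L s (labels_of x) = match_count ((!) s) (length s) x L / 2 ^ L"
proof -
  let ?R = "\<lambda>t. output_begins ((!) s) (length s) (\<lambda>k. labels_of x (take (Suc k) t)) L"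
  let ?R' = "\<lambda>u. output_begins ((!) s) (length s) (\<lambda>k. x ((2 ^ L + u) div 2 ^ (L - Suc k) - 2)) L"
  have eq: "?R t = ?R' (Suc (str_index t) - 2 ^ L)" if "length t = L" for t
  proof (rule output_begins_cong)
    fix k assume "k < L"
    then have "Suc (str_index (take (Suc k) t)) = Suc (str_index t) div 2 ^ (L - Suc k)"
      using str_index_take[of "Suc k" t] that by simp
    moreover have "2 ^ L + (Suc (str_index t) - 2 ^ L) = Suc (str_index t)"
      using str_index_range[of t] that by simp
    ultimately show "labels_of x (take (Suc k) t) =
        x ((2 ^ L + (Suc (str_index t) - 2 ^ L)) div 2 ^ (L - Suc k) - 2)"
      unfolding labels_of_def by (metis Suc_1 diff_Suc_Suc One_nat_def)
  qed simp
  have fin: "finite {t :: bool list. length t = L}"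
    using finite_lists_length_eq[of "UNIV :: bool set" L] by simp
  have "card {t. length t = L \<and> ?R t} = (\<Sum>t\<in>{t. length t = L}. if ?R t then 1 else 0)"
    using fin by (simp add: sum.If_cases Int_def)
  also have "\<dots> = (\<Sum>t\<in>{t. length t = L}. if ?R' (Suc (str_index t) - 2 ^ L) then 1 else 0)"
    by (intro sum.cong) (auto simp: eq)
  also have "\<dots> = match_count ((!) s) (length s) x L"
    unfolding match_count_def by (rule sum.reindex_bij_betw[OF bij_betw_strings])
  finally show ?thesis by (simp add: match_mass_eq_card)
qed

lemma match_count_cong:
  assumes "\<And>j. j < 2 ^ Suc L \<Longrightarrow> x j = y j"
  shows "match_count \<tau> n x L = match_count \<tau> n y L"
  unfolding match_count_def
proof (intro sum.cong refl if_cong output_begins_cong assms)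
  fix u k :: nat assume "u \<in> {..<2 ^ L}"
  have "(2 ^ L + u) div 2 ^ (L - Suc k) - 2 \<le> 2 ^ L + u"
    by (meson diff_le_self div_le_dividend order_trans)
  also have "\<dots> < 2 ^ Suc L" using \<open>u \<in> _\<close> by simp
  finally show "(2 ^ L + u) div 2 ^ (L - Suc k) - 2 < 2 ^ Suc L" .
qed

text \<open>A string enters the test as binary digits of a number; its length is fixed by the level
  of the test.\<close>

lemma exists_code_of_string: "\<exists>w. \<forall>j<length s. (w div 2 ^ j mod 2 = (1::nat)) = s ! j"
proof (intro exI allI impI)
  fix j assume "j < length s"
  then show "(horner_sum of_bool 2 s div 2 ^ j mod 2 = (1::nat)) = s ! j"
    using bit_horner_sum_bit_iff[of s j, where 'a = nat] by (simp add: bit_iff_odd odd_iff_mod_2_eq_one)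
qed

text \<open>The witness \<open>m\<close> codes the level \<open>L\<close> and a string \<open>\<sigma>\<close> of length \<open>60 i + 1\<close>.\<close>
definition large_mass :: "nat \<Rightarrow> nat \<Rightarrow> (nat \<Rightarrow> nat) \<Rightarrow> bool" where
  "large_mass i m x \<longleftrightarrow> 16 ^ (60 * i) * 2 ^ fst (prod_decode m) <
     match_count (\<lambda>j. snd (prod_decode m) div 2 ^ j mod 2 = 1) (Suc (60 * i)) x (fst (prod_decode m)) * 25 ^ (60 * i)"

lemma large_mass_iff:
  "(\<exists>m. large_mass i m x) \<longleftrightarrow>
    (\<exists>s L. length s = Suc (60 * i) \<and> (16/25) ^ (60 * i) < match_mass L s (labels_of x))"
proof -
  have eq: "(16/25) ^ n < real c / 2 ^ L \<longleftrightarrow> 16 ^ n * 2 ^ L < c * (25::nat) ^ n" for n L c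
  proof -
    have "(16/25) ^ n < real c / 2 ^ L \<longleftrightarrow> 16 ^ n * 2 ^ L < real c * 25 ^ n"
      by (simp add: field_simps power_divide)
    also have "\<dots> \<longleftrightarrow> real (16 ^ n * 2 ^ L) < real (c * 25 ^ n)" by simp
    finally show ?thesis by (simp only: of_nat_less_iff)
  qed
  show ?thesis
  proof
    assume "\<exists>m. large_mass i m x"
    then obtain m where m: "large_mass i m x" ..
    define L w where "L = fst (prod_decode m)" and "w = snd (prod_decode m)"
    define s where "s = map (\<lambda>j. w div 2 ^ j mod 2 = 1) [0..<Suc (60 * i)]"
    have len: "length s = Suc (60 * i)" by (simp add: s_def)
    have "match_count ((!) s) (Suc (60 * i)) x L = match_count (\<lambda>j. w div 2 ^ j mod 2 = 1) (Suc (60 * i)) x L"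
      unfolding match_count_def by (intro sum.cong refl if_cong output_begins_cong) (auto simp: s_def simp del: upt_Suc)
    then have "(16/25) ^ (60 * i) < match_mass L s (labels_of x)"
      using m unfolding match_mass_eq_count eq large_mass_def len L_def[symmetric] w_def[symmetric] by simp
    then show "\<exists>s L. length s = Suc (60 * i) \<and> (16/25) ^ (60 * i) < match_mass L s (labels_of x)"
      using len by blast
  next
    assume "\<exists>s L. length s = Suc (60 * i) \<and> (16/25) ^ (60 * i) < match_mass L s (labels_of x)"
    then obtain s L where s: "length s = Suc (60 * i)" "(16/25) ^ (60 * i) < match_mass L s (labels_of x)" by blast
    obtain w :: nat where w: "\<And>j. j < Suc (60 * i) \<Longrightarrow> s ! j = (w div 2 ^ j mod 2 = 1)"
      using exists_code_of_string[of s] s(1) by metis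
    have "match_count ((!) s) (Suc (60 * i)) x L = match_count (\<lambda>j. w div 2 ^ j mod 2 = 1) (Suc (60 * i)) x L"
      unfolding match_count_def by (intro sum.cong refl if_cong output_begins_cong) (simp_all only: w)
    then have "large_mass i (prod_encode (L, w)) x"
      using s(2) unfolding match_mass_eq_count eq large_mass_def s(1) by simp
    then show "\<exists>m. large_mass i m x" ..
  qed
qed

lemma decidable_large_mass: "decidable 3 (\<lambda>xs. large_mass (xs ! 0) (xs ! 1) (code_nth (xs ! 2)))"
  unfolding large_mass_def match_count_def output_begins_def output_length_def
  by (intro rec_intros) simp_all

lemma large_mass_cong:
  assumes "\<And>j. j < 2 ^ Suc (fst (prod_decode m)) \<Longrightarrow> x j = y j"
  shows "large_mass i m x = large_mass i m y"
  unfolding large_mass_def using match_count_cong[OF assms] by simp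

text \<open>The union over \<open>L\<close> costs nothing, since the events increase with
  \<open>L\<close> and a limit suffices; the union over strings costs the factor
  \<open>2 ^ (n + 1)\<close>.\<close>

lemma measure_large_mass_le:
  "measure (unif_seq 3) {x \<in> seq_space 3. \<exists>m. large_mass i m x} \<le> (1/2) ^ i"
proof -
  interpret prob_space "unif_seq 3" by (rule prob_space_unif_seq)
  define n where "n = 60 * i"
  define A where "A s L = {x. (16/25) ^ n < match_mass L s (labels_of x)}" for s L
  have meas: "(\<lambda>x. match_mass L s (labels_of x)) \<in> borel_measurable (unif_seq 3)" for L s
    by (rule borel_measurable_unif_seq[of "2 ^ Suc L"])
       (simp only: match_mass_eq_count, metis match_count_cong)
  have A_sets: "A s L \<in> events" for s L
  proof -
    have "{x \<in> space (unif_seq 3). (16/25) ^ n < match_mass L s (labels_of x)} \<in> events"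
      using meas by measurable
    then show ?thesis by (simp add: A_def space_unif_seq)
  qed
  have A_le: "prob (A s L) \<le> (15/8) * (1/8 / (16/25) ^ 3) ^ n" if "length s = Suc n" for s L
  proof -
    have s: "s \<noteq> []" using that by auto
    have int: "integrable (unif_seq 3) (\<lambda>x. match_mass L s (labels_of x) ^ 3)"
      by (rule integrable_const_bound[OF AE_I2, where B = 1])
         (use match_mass_bounds meas in \<open>auto simp: power_abs power_le_one\<close>)
    have "prob (A s L) \<le> prob {x \<in> space (unif_seq 3). match_mass L s (labels_of x) ^ 3 \<ge> ((16/25) ^ n) ^ 3}"
    proof (rule finite_measure_mono)
      show "{x \<in> space (unif_seq 3). match_mass L s (labels_of x) ^ 3 \<ge> ((16/25) ^ n) ^ 3} \<in> events"
        using meas by measurable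
    qed (auto simp: A_def space_unif_seq intro!: power_mono)
    also have "\<dots> \<le> (\<integral>x. match_mass L s (labels_of x) ^ 3 \<partial>unif_seq 3) / ((16/25) ^ n) ^ 3"
      by (rule integral_Markov_inequality_measure[OF int, of "{}"])
         (use match_mass_bounds in auto)
    also have "\<dots> \<le> 15 * (1/8) ^ Suc n / ((16/25) ^ n) ^ 3"
      using integral_match_mass_labels[OF s, of L] that by (intro divide_right_mono) auto
    also have "\<dots> = (15/8) * (1/8 / (16/25) ^ 3) ^ n"
    proof -
      have "((16/25 :: real) ^ n) ^ 3 = ((16/25) ^ 3) ^ n" by (simp only: power_mult[symmetric] mult.commute)
      moreover have "(1/8 :: real) ^ n / ((16/25) ^ 3) ^ n = (1/8 / (16/25) ^ 3) ^ n" by (rule power_divide[symmetric])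
      ultimately show ?thesis by simp
    qed
    finally show ?thesis .
  qed
  have "prob (\<Union>L. A s L) \<le> (15/8) * (1/8 / (16/25) ^ 3) ^ n" if "length s = Suc n" for s
  proof (rule LIMSEQ_le_const2)
    show "(\<lambda>L. prob (A s L)) \<longlonglongrightarrow> prob (\<Union>L. A s L)"
    proof (rule finite_Lim_measure_incseq)
      show "incseq (A s)"
        by (rule incseq_SucI) (auto simp: A_def intro: less_le_trans match_mass_mono)
    qed (use A_sets in auto)
    show "\<exists>N. \<forall>L\<ge>N. prob (A s L) \<le> (15/8) * (1/8 / (16/25) ^ 3) ^ n"
      using A_le[OF that] by blast
  qed
  note le = this
  let ?S = "{s :: bool list. length s = Suc n}"
  have card: "finite ?S" "card ?S = 2 ^ Suc n"
    using card_lists_length_eq[of "UNIV :: bool set" "Suc n"] finite_lists_length_eq[of "UNIV :: bool set" "Suc n"]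
    by auto
  have "prob {x \<in> seq_space 3. \<exists>m. large_mass i m x} \<le> prob (\<Union>s\<in>?S. \<Union>L. A s L)"
    using A_sets by (intro finite_measure_mono) (auto simp: large_mass_iff A_def n_def card)
  also have "\<dots> \<le> (\<Sum>s\<in>?S. prob (\<Union>L. A s L))"
    using A_sets by (intro finite_measure_subadditive_finite) (auto simp: card)
  also have "\<dots> \<le> (\<Sum>s\<in>?S. (15/8) * (1/8 / (16/25) ^ 3) ^ n)"
    by (intro sum_mono le) auto
  also have "\<dots> = (15/4) * (2 * (1/8 / (16/25) ^ 3)) ^ n"
    unfolding sum_constant card(2) power_mult_distrib[of 2] by simp
  \<comment> \<open>This is \<open>25 ^ 3 / (4 * 16 ^ 3)\<close>, and the choice of 16/25 makes it
    less than 1.\<close>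
  also have "2 * (1/8 / (16/25) ^ 3) = (15625/16384 :: real)" by (simp add: power3_eq_cube)
  finally have main: "prob {x \<in> seq_space 3. \<exists>m. large_mass i m x} \<le> (15/4) * ((15625/16384) ^ 60) ^ i"
    by (simp add: n_def power_mult)
  show ?thesis
  \<comment> \<open>For i = 0 the bound is 1 and trivial; for larger i the factor 15/4 is at most
    its i-th power and is absorbed by the 60th power.\<close>
  proof (cases i)
    case 0 then show ?thesis by simp
  next
    case (Suc j)
    have "(15/4) * ((15625/16384 :: real) ^ 60) ^ i \<le> (15/4) ^ i * ((15625/16384) ^ 60) ^ i"
      by (intro mult_right_mono) (auto simp: Suc intro!: self_le_power)
    also have "\<dots> = ((15/4) * (15625/16384) ^ 60) ^ i" by (rule power_mult_distrib[symmetric])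
    also have "\<dots> \<le> (1/2) ^ i" by (intro power_mono) (simp_all add: power_divide)
    finally show ?thesis using main by simp
  qed
qed

lemma mlrandom_small_mass:
  assumes "mlrandom 3 x"
  shows "\<exists>i0. \<forall>i\<ge>i0. \<forall>s L. length s = Suc (60 * i) \<longrightarrow> match_mass L s (labels_of x) \<le> (16/25) ^ (60 * i)"
proof -
  have "\<exists>i0. \<forall>i\<ge>i0. \<forall>m. \<not> large_mass i m x"
  proof (rule mlrandom_eventually_avoids[OF assms, where N = "\<lambda>i m. 2 ^ Suc (fst (prod_decode m))"])
    show "total_rec 2 (\<lambda>xs. 2 ^ Suc (fst (prod_decode (xs ! 1))))" by (intro rec_intros) simp_all
    show "large_mass i m y" if "\<And>j. j < 2 ^ Suc (fst (prod_decode m)) \<Longrightarrow> x j = y j" "large_mass i m x" for i m x y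
      using large_mass_cong[of m x y i] that by blast
  qed (rule decidable_large_mass measure_large_mass_le)+
  then show ?thesis using large_mass_iff by (meson not_le)
qed

section \<open>Lebesgue measure of preimages of cylinders\<close>

lemma measure_cantor_cylB: "measure cantor (cylB s) = (1/2) ^ length s"
proof -
  let ?N = "measure_pmf (pmf_of_set (UNIV :: bool set))"
  have "cylB s = prod_emb UNIV (\<lambda>_. ?N) {..<length s} (\<Pi>\<^sub>E i\<in>{..<length s}. {s ! i})"
    by (auto simp: cylB_def prod_emb_def space_PiM restrict_def PiE_iff extensional_def)
  then have "emeasure cantor (cylB s) = (\<Prod>i<length s. emeasure ?N {s ! i})"
    unfolding cantor_def by (simp only:) (rule emeasure_PiM_emb, auto intro: measure_pmf.prob_space_axioms)
  also have "\<dots> = (\<Prod>i<length s. ennreal (1/2))"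
    by (intro prod.cong refl) (simp add: emeasure_pmf_single)
  also have "\<dots> = ennreal ((1/2) ^ length s)"
    by (simp only: prod_constant card_lessThan) (rule ennreal_power, simp)
  finally show ?thesis by (simp add: measure_def)
qed

lemma measure_cantor_output:
  "measure cantor {y. output_begins ((!) s) (length s) (lab x y) L} = match_mass L s (labels_of x)"
proof -
  interpret prob_space cantor by (rule prob_space_cantor)
  let ?T = "{t. length t = L \<and> output_begins ((!) s) (length s) (\<lambda>k. labels_of x (take (Suc k) t)) L}"
  have fin: "finite ?T"
    by (rule finite_subset[OF _ finite_lists_length_eq[of "UNIV :: bool set" L]]) auto
  have eq: "output_begins ((!) s) (length s) (lab x y) L =
      output_begins ((!) s) (length s) (\<lambda>k. labels_of x (take (Suc k) (map y [0..<L]))) L" for y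
    by (rule output_begins_cong) (simp_all add: lab_def labels_of_def take_map del: upt_Suc)
  have "{y. output_begins ((!) s) (length s) (lab x y) L} = (\<Union>t\<in>?T. cylB t)"
  proof (intro equalityI subsetI)
    fix y assume "y \<in> {y. output_begins ((!) s) (length s) (lab x y) L}"
    then have "map y [0..<L] \<in> ?T" using eq[of y] by simp
    moreover have "y \<in> cylB (map y [0..<L])" by (simp add: cylB_iff_map)
    ultimately show "y \<in> (\<Union>t\<in>?T. cylB t)" by blast
  next
    fix y assume "y \<in> (\<Union>t\<in>?T. cylB t)"
    then obtain t where "t \<in> ?T" "map y [0..<length t] = t" unfolding cylB_iff_map[symmetric] by blast
    then show "y \<in> {y. output_begins ((!) s) (length s) (lab x y) L}" using eq[of y] by auto
  qed
  then have "prob {y. output_begins ((!) s) (length s) (lab x y) L} = prob (\<Union>t\<in>?T. cylB t)" by simp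
  also have "\<dots> = (\<Sum>t\<in>?T. prob (cylB t))"
    by (rule finite_measure_finite_Union[OF fin])
       (auto simp: cylB_sets disjoint_family_on_def cylB_iff_map)
  also have "\<dots> = card ?T / 2 ^ L"
    by (simp add: measure_cantor_cylB power_divide)
  finally show ?thesis by (simp add: match_mass_eq_card)
qed

lemma output_length_enumerate:
  assumes "infinite {k. l k \<noteq> 2}"
  shows "output_length l (enumerate {k. l k \<noteq> 2} j) = j"
proof -
  let ?S = "{k. l k \<noteq> 2}"
  have "output_length l (enumerate ?S j) = card {k. k < enumerate ?S j \<and> l k \<noteq> 2}"
    unfolding output_length_def by (simp add: sum.If_cases Int_def)
  also have "{k. k < enumerate ?S j \<and> l k \<noteq> 2} = enumerate ?S ` {..<j}"
  proof (intro equalityI subsetI)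
    fix k assume k: "k \<in> {k. k < enumerate ?S j \<and> l k \<noteq> 2}"
    then obtain i where "enumerate ?S i = k" using enumerate_Ex[of ?S k] assms by auto
    then show "k \<in> enumerate ?S ` {..<j}" using k enumerate_mono_iff[OF assms] by auto
  qed (use enumerate_in_set[OF assms] enumerate_mono_iff[OF assms] in auto)
  also have "card \<dots> = j"
    using inj_enumerate[OF assms] by (simp add: card_image inj_on_subset)
  finally show ?thesis .
qed

lemma Fx_cylB_imp_output_begins:
  assumes "Fx x y \<in> cylB s" "True \<in> set s"
  shows "\<exists>L. output_begins ((!) s) (length s) (lab x y) L"
proof -
  let ?S = "{k. lab x y k \<noteq> 2}"
  \<comment> \<open>With finitely many symbols the totalised value is constantly
    \<open>False\<close>, which the entry \<open>True\<close> of \<open>s\<close> excludes.\<close>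
  have inf: "infinite ?S"
  proof
    assume "finite ?S"
    then have "\<not> Fx x y j" for j by (simp add: Fx_def)
    then show False using assms by (auto simp: cylB_def in_set_conv_nth)
  qed
  \<comment> \<open>The witness is the position of the symbol numbered \<open>length s\<close>,
    counting from 0: exactly that many symbols are printed before it.\<close>
  have "output_begins ((!) s) (length s) (lab x y) (enumerate ?S (length s))"
    unfolding output_begins_def
  proof (intro conjI allI impI)
    show "length s \<le> output_length (lab x y) (enumerate ?S (length s))"
      by (simp add: output_length_enumerate[OF inf])
    fix k assume k: "lab x y k \<noteq> 2 \<and> output_length (lab x y) k < length s"
    then obtain j where j: "enumerate ?S j = k" using enumerate_Ex[of ?S k] inf by auto
    then have "output_length (lab x y) k = j" using output_length_enumerate[OF inf, of j] by simp
    moreover have "Fx x y j = (lab x y k = 1)" using inf j by (simp add: Fx_def)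
    ultimately show "(lab x y k = 1) = s ! output_length (lab x y) k"
      using k assms(1) by (simp add: cylB_def)
  qed
  then show ?thesis ..
qed

text \<open>For nonmeasurable \<open>f\<close> junk values work in our favour: \<open>distr\<close> is null unless it is a measure,
  and nonmeasurable sets have \<open>emeasure\<close> 0.\<close>
lemma emeasure_distr_le:
  assumes "f -` A \<inter> space M \<subseteq> B" "B \<in> sets M"
  shows "emeasure (distr M N f) A \<le> emeasure M B"
  using assms unfolding distr_def emeasure_measure_of_conv by (auto intro: emeasure_mono)

text \<open>The preimage of the cylinder lies in the increasing union of the clopen events
  \<open>D L\<close>, each of mass at most \<open>c\<close>.\<close>

lemma measure_induced_le:
  assumes "True \<in> set s" "\<And>L. match_mass L s (labels_of x) \<le> c"
  shows "measure (distr cantor cantor (Fx x)) (cylB s) \<le> c"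
proof -
  interpret prob_space cantor by (rule prob_space_cantor)
  define D where "D L = {y. output_begins ((!) s) (length s) (lab x y) L}" for L
  have D_sets: "D L \<in> events" for L
  proof -
    have "D L = (\<Union>t\<in>{t. length t = L \<and> (\<forall>y\<in>cylB t. y \<in> D L)}. cylB t)"
    proof (intro equalityI subsetI; clarsimp)
      fix y assume "y \<in> D L"
      then have "y' \<in> D L" if "y' \<in> cylB (map y [0..<L])" for y'
      proof -
        have "lab x y' k = lab x y k" if "k < L" for k
        proof -
          have "map y' [0..<Suc k] = map y [0..<Suc k]"
            using that \<open>y' \<in> _\<close> by (intro map_cong) (auto simp: cylB_def)
          then show ?thesis unfolding lab_def by (simp only:)
        qed
        then have "output_begins ((!) s) (length s) (lab x y') L = output_begins ((!) s) (length s) (lab x y) L"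
          by (rule output_begins_cong) simp_all
        then show ?thesis using \<open>y \<in> D L\<close> by (simp add: D_def)
      qed
      then show "\<exists>t. length t = L \<and> (\<forall>y\<in>cylB t. y \<in> D L) \<and> y \<in> cylB t"
        by (intro exI[of _ "map y [0..<L]"]) (auto simp: cylB_iff_map)
    qed
    also have "\<dots> \<in> events"
      by (intro sets.countable_UN' countableI_type) (auto intro: cylB_sets)
    finally show ?thesis .
  qed
  have "prob (\<Union>L. D L) \<le> c"
  proof (rule LIMSEQ_le_const2)
    show "(\<lambda>L. prob (D L)) \<longlonglongrightarrow> prob (\<Union>L. D L)"
    proof (rule finite_Lim_measure_incseq)
      show "incseq D"
        by (rule incseq_SucI) (auto simp: D_def intro: output_begins_mono)
    qed (use D_sets in auto)
    show "\<exists>N. \<forall>L\<ge>N. prob (D L) \<le> c"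
      using assms(2) by (simp add: D_def measure_cantor_output)
  qed
  then have c: "0 \<le> c" "ennreal (prob (\<Union>L. D L)) \<le> ennreal c"
    using measure_nonneg[of cantor "\<Union>L. D L"] by (auto intro: ennreal_leI simp del: measure_nonneg)
  have "emeasure (distr cantor cantor (Fx x)) (cylB s) \<le> emeasure cantor (\<Union>L. D L)"
    using Fx_cylB_imp_output_begins[OF _ assms(1)] D_sets
    by (intro emeasure_distr_le) (auto simp: D_def)
  also have "\<dots> \<le> ennreal c" using c(2) by (simp add: emeasure_eq_measure)
  finally show ?thesis unfolding measure_def using c(1) by (intro enn2real_leI)
qed

theorem theorem6p13:
  assumes "random_continuous_function F"
  shows "\<not> random_measure (distr cantor cantor F)"
proof
  assume "random_measure (distr cantor cantor F)"
  then obtain z where z: "mlrandom 2 z" "distr cantor cantor F = mu_of z"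
    by (auto simp: random_measure_def)
  obtain x where x: "mlrandom 3 x" "F = Fx x"
    using assms by (auto simp: random_continuous_function_def)
  obtain \<delta> i1 where \<delta>: "0 < \<delta>" and heavy: "\<And>i. i \<ge> i1 \<Longrightarrow> \<exists>s. length s = Suc (60 * i) \<and> True \<in> set s \<and>
     \<delta> * (13/20) ^ (60 * i) \<le> measure (mu_of z) (cylB s)"
    using mlrandom_heavy_cylinders[OF z(1)] by blast
  obtain i2 where small: "\<And>i s L. i \<ge> i2 \<Longrightarrow> length s = Suc (60 * i) \<Longrightarrow>
     match_mass L s (labels_of x) \<le> (16/25) ^ (60 * i)"
    using mlrandom_small_mass[OF x(1)] by blast
  \<comment> \<open>64/65 is the quotient of 16/25 and 13/20; its powers eventually fall below the
    constant \<delta>, about which nothing but positivity is known.\<close>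
  obtain k where k: "(64/65) ^ k < \<delta>" using real_arch_pow_inv[OF \<delta>, of "64/65"] by auto
  define i where "i = max k (max i1 i2)"
  have i: "k \<le> i" "i1 \<le> i" "i2 \<le> i" by (auto simp: i_def)
  obtain s where s: "length s = Suc (60 * i)" "True \<in> set s"
      "\<delta> * (13/20) ^ (60 * i) \<le> measure (mu_of z) (cylB s)"
    using heavy[OF i(2)] by blast
  have "\<delta> * (13/20) ^ (60 * i) \<le> (16/25) ^ (60 * i)"
    using s(3) measure_induced_le[OF s(2) small[OF i(3) s(1)]] unfolding z(2)[symmetric] x(2)
    by linarith
  then have "\<delta> \<le> (16/25) ^ (60 * i) / (13/20) ^ (60 * i)"
    by (simp add: pos_le_divide_eq)
  also have "\<dots> = (64/65) ^ (60 * i)" by (simp flip: power_divide)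
  also have "\<dots> \<le> (64/65) ^ k" by (rule power_decreasing) (use i(1) in auto)
  finally show False using k by simp
qed

end
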